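(* Let $k\ge3$, $t\ge k+1$ and $a=t-2$, and assume that $n\ge a+1$. Let $B^{(k)}_{n,t}=\mathcal C_k\bigl(K_a\vee\overline{K_{n-a}}\bigr)$. Then $B^{(k)}_{n,t}\in\mathcal H^{(k)}_{K_t}(n)$, and its spectral radius is the unique root in the interval $\bigl(\binom{a-1}{k-1},\infty\bigr)$ of $$\lambda\Bigl(\lambda-\binom{a-1}{k-1}\Bigr)^{k-1}=\binom{a-1}{k-2}^{k-1}\binom{a}{k-1}(n-a)^{k-1},$$ and, for fixed $k,t$ and $n\to\infty$, $\rho\bigl(B^{(k)}_{n,t}\bigr)=\bigl(c_{k,t}+o(1)\bigr)n^{(k-1)/k}$ with $c_{k,t}=\binom{t-3}{k-2}^{(k-1)/k}\binom{t-2}{k-1}^{1/k}$. For $t=k+1$ the equation degenerates to $\lambda^{k}=(n-k+1)^{k-1}$. Moreover, for fixed $k,t$ and all sufficiently large $n$, $B^{(k)}_{n,t}$ is, up to isomorphism, the unique hypergraph of maximum spectral radius in $\mathcal H^{(k)}_{K_t}(n)$.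
   Context: All graphs are simple and finite; $\vee$ denotes the join of graphs, $\overline{G}$ the complement. For a $k$-uniform hypergraph $\mathcal H$, the (adjacency-tensor) spectral radius is $$\rho(\mathcal H)=\max\Bigl\{k\sum_{F\in E(\mathcal H)}\prod_{v\in F}x_v:\ x\in\mathbb R^{V(\mathcal H)}_{\ge0},\ \sum_v x_v^k=1\Bigr\}.$$ The shadow $\partial_2\mathcal H$ is the graph on $V(\mathcal H)$ whose edges are the pairs $\{u,v\}$ contained in some hyperedge. For a graph $M$, $\mathcal H^{(k)}_M(n)$ is the class of $k$-uniform hypergraphs on $n$ vertices whose shadow has no $M$ minor. For a graph $G$, $\mathcal C_k(G)$ is the $k$-uniform hypergraph on $V(G)$ whose edges are the vertex sets of $k$-cliques of $G$. *)

theory Defs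
  imports Complex_Main "HOL-Library.Ramsey"
begin

record 'a hypergraph =
  vertices :: "'a set"
  edges :: "'a set set"

definition uniform_hypergraph :: "nat \<Rightarrow> 'a hypergraph \<Rightarrow> bool" where
  "uniform_hypergraph k H \<longleftrightarrow> finite (vertices H) \<and> edges H \<subseteq> [vertices H]\<^bsup>k\<^esup>"

text \<open>Graphs are 2-uniform hypergraphs: the edges are two-element vertex sets.\<close>

type_synonym 'a graph = "'a hypergraph"

definition complete_graph :: "nat \<Rightarrow> nat graph" where
  "complete_graph n = \<lparr>vertices = {..<n}, edges = [{..<n}]\<^bsup>2\<^esup>\<rparr>"

definition graph_complement :: "'a graph \<Rightarrow> 'a graph" where
  "graph_complement G = \<lparr>vertices = vertices G, edges = [vertices G]\<^bsup>2\<^esup> - edges G\<rparr>"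

definition graph_join :: "'a graph \<Rightarrow> 'b graph \<Rightarrow> ('a + 'b) graph" where
  "graph_join G H =
     \<lparr>vertices = vertices G <+> vertices H,
      edges = (`) Inl ` edges G \<union> (`) Inr ` edges H
              \<union> {{Inl u, Inr v} | u v. u \<in> vertices G \<and> v \<in> vertices H}\<rparr>"

definition connected_in :: "'a graph \<Rightarrow> 'a set \<Rightarrow> bool" where
  "connected_in G S \<longleftrightarrow>
     S \<noteq> {} \<and> (\<forall>x\<in>S. \<forall>y\<in>S. (x, y) \<in> {(u, v). u \<in> S \<and> v \<in> S \<and> {u, v} \<in> edges G}\<^sup>*)"

text \<open>\<^term>\<open>M\<close> is a minor of \<^term>\<open>G\<close> if \<^term>\<open>G\<close> has pairwise disjoint connected branch sets,
  one for each vertex of \<^term>\<open>M\<close>, such that adjacent vertices of \<^term>\<open>M\<close> have branch sets joined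
  by an edge of \<^term>\<open>G\<close>.\<close>

definition has_minor :: "'a graph \<Rightarrow> 'b graph \<Rightarrow> bool" where
  "has_minor G M \<longleftrightarrow>
     (\<exists>\<beta>. (\<forall>u\<in>vertices M. \<beta> u \<subseteq> vertices G \<and> connected_in G (\<beta> u))
        \<and> (\<forall>u\<in>vertices M. \<forall>v\<in>vertices M. u \<noteq> v \<longrightarrow> \<beta> u \<inter> \<beta> v = {})
        \<and> (\<forall>u\<in>vertices M. \<forall>v\<in>vertices M. {u, v} \<in> edges M \<longrightarrow>
             (\<exists>x\<in>\<beta> u. \<exists>y\<in>\<beta> v. {x, y} \<in> edges G)))"

definition shadow :: "'a hypergraph \<Rightarrow> 'a graph" where
  "shadow H =
     \<lparr>vertices = vertices H, edges = {{u, v} | u v. u \<noteq> v \<and> (\<exists>F\<in>edges H. {u, v} \<subseteq> F)}\<rparr>"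

definition minor_free_shadow_class :: "nat \<Rightarrow> 'b graph \<Rightarrow> nat \<Rightarrow> 'a hypergraph set" where
  "minor_free_shadow_class k M n =
     {H. uniform_hypergraph k H \<and> card (vertices H) = n \<and> \<not> has_minor (shadow H) M}"

definition clique_hypergraph :: "nat \<Rightarrow> 'a graph \<Rightarrow> 'a hypergraph" where
  "clique_hypergraph k G =
     \<lparr>vertices = vertices G, edges = {S \<in> [vertices G]\<^bsup>k\<^esup>. clique S (edges G)}\<rparr>"

text \<open>The maximum exists by compactness as soon as there is a vertex and \<^prop>\<open>k > 0\<close>.
  Weight vectors are functions on the whole type; their values outside the vertex set are
  irrelevant.\<close>

definition spectral_radius :: "nat \<Rightarrow> 'a hypergraph \<Rightarrow> real" where
  "spectral_radius k H =
     (GREATEST r. \<exists>x :: 'a \<Rightarrow> real.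
        (\<forall>v\<in>vertices H. 0 \<le> x v) \<and> (\<Sum>v\<in>vertices H. x v ^ k) = 1
        \<and> r = real k * (\<Sum>F\<in>edges H. \<Prod>v\<in>F. x v))"

definition hypergraph_iso :: "'a hypergraph \<Rightarrow> 'b hypergraph \<Rightarrow> bool" where
  "hypergraph_iso H H' \<longleftrightarrow>
     (\<exists>f. bij_betw f (vertices H) (vertices H') \<and> (`) f ` edges H = edges H')"

definition B_hypergraph :: "nat \<Rightarrow> nat \<Rightarrow> nat \<Rightarrow> (nat + nat) hypergraph" where
  "B_hypergraph k n t =
     clique_hypergraph k
       (graph_join (complete_graph (t - 2)) (graph_complement (complete_graph (n - (t - 2)))))"

definition B_equation :: "nat \<Rightarrow> nat \<Rightarrow> nat \<Rightarrow> real \<Rightarrow> bool" where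
  "B_equation k a n r \<longleftrightarrow>
     r * (r - real ((a - 1) choose (k - 1))) ^ (k - 1)
       = real ((a - 1) choose (k - 2)) ^ (k - 1) * real (a choose (k - 1)) * (real n - real a) ^ (k - 1)"

definition B_constant :: "nat \<Rightarrow> nat \<Rightarrow> real" where
  "B_constant k t =
     real ((t - 3) choose (k - 2)) powr ((real k - 1) / real k)
       * real ((t - 2) choose (k - 1)) powr (1 / real k)"

end

(*
Writing e_j for elementary symmetric sums, AM-GM with a scaling parameter chosen as the ratio of the two
entries of the principal eigenvector bounds the Rayleigh quotient of B sharply, which determines its
spectral radius.

For the extremal part let x be an optimal weight vector of a hypergraph H whose spectral radius is at
least that of B. The shadow is degenerate, so edges with two light vertices are negligible, and all but
O(1) light vertices v see a set of heavy vertices that is shared by many light vertices; such a set has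
at most a = t - 2 elements, as otherwise K_t is a minor. AM-GM then yields a set A of a vertices with many
common neighbours that carries almost all of the weight available for the heavy side. The common
neighbours N of A are independent, and every remaining vertex has at most one neighbour in N, since
otherwise contracting a matching between A and N gives K_t. Hence per unit of entry x_v a remaining vertex
v earns strictly less than e_(k-1)(x_A), which is what a vertex of N earns, and comparison with B forces
H to be isomorphic to B.
*)

theory Submission
  imports Defs "HOL-Analysis.Analysis"
begin

section \<open>Elementary symmetric sums\<close>

text \<open>The obstacle is that the optimal vector may be spread over all \<open>n\<close>
  vertices. By the power mean inequality the light entries have total X at most Q =
  \<open>n powr ((k - 1) / k)\<close>, and y = X / Q satisfies: y^k is at most the light share of
  the norm. So the light side acts as one virtual entry, and up to a small fraction of Q the problem
  is to maximise k e_(k-1)(x_S) y over boundedly many entries of norm at most 1. The value is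
  \<open>B_constant k t\<close> if S has a elements and smaller by a fixed factor \<gamma> < 1 if S
  has fewer.

  This gap is used twice: it excludes small S, and it makes a vertex that misses a neighbour in S
  earn strictly less than a common neighbour of S. It is also the source of all constants, which are
  fixed before n and independently of H.

  The final comparison is exact: the same r bounds the weight from both sides, so every inequality
  in between is an equality. The optimal vector is only known to be nonnegative at first; its
  positivity comes out of these equalities.\<close>

definition esym :: "nat \<Rightarrow> ('a \<Rightarrow> real) \<Rightarrow> 'a set \<Rightarrow> real" where
  "esym j x S = (\<Sum>T\<in>nsets S j. \<Prod>v\<in>T. x v)"

text \<open>AM-GM for the numbers \<open>x v ^ card S\<close>; taking this power first cancels the
  root in the geometric mean.\<close>

lemma prod_le_sum_powers:
  fixes x :: "'a \<Rightarrow> real"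
  assumes "finite S" "S \<noteq> {}" "\<And>v. v \<in> S \<Longrightarrow> 0 \<le> x v"
  shows "card S * (\<Prod>v\<in>S. x v) \<le> (\<Sum>v\<in>S. x v ^ card S)"
proof -
  let ?n = "card S"
  have n: "?n > 0" using assms by (simp add: card_gt_0_iff)
  have "(\<Prod>v\<in>S. x v ^ ?n) powr (1 / ?n) = (\<Prod>v\<in>S. x v)"
  proof -
    have "(\<Prod>v\<in>S. x v ^ ?n) = (\<Prod>v\<in>S. x v) ^ ?n"
      by (simp add: prod_power_distrib)
    moreover have "0 \<le> (\<Prod>v\<in>S. x v)" using assms by (simp add: prod_nonneg)
    ultimately show ?thesis
      using n by (simp add: root_powr_inverse[symmetric] real_root_power_cancel)
  qed
  then have "(\<Prod>v\<in>S. x v) \<le> (\<Sum>v\<in>S. x v ^ ?n / ?n)"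
    using arith_geom_mean[of S "\<lambda>v. x v ^ ?n"] assms by simp
  then show ?thesis
    using n by (simp add: field_simps flip: sum_divide_distrib)
qed

text \<open>Jensen's inequality for the convex function \<open>z ^ k\<close> with equal weights. It
  is the source of the scale n^((k-1)/k).\<close>

lemma power_sum_le:
  fixes x :: "'a \<Rightarrow> real"
  assumes "finite S" "\<And>v. v \<in> S \<Longrightarrow> 0 \<le> x v" "k > 0" 
  shows "(\<Sum>v\<in>S. x v) ^ k \<le> real (card S) ^ (k - 1) * (\<Sum>v\<in>S. x v ^ k)"
proof (cases "S = {}")
  case False
  let ?n = "real (card S)"
  have n: "?n > 0" using False assms by (simp add: card_gt_0_iff)
  have "convex_on {0::real..} (\<lambda>x. x ^ k)"
    using convex_power_even convex_power_odd convex_on_subset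
    by (metis convex_real_interval(1) top_greatest)
  from convex_on_sum[OF assms(1) False this, of "\<lambda>_. 1 / ?n" x]
  have "(\<Sum>v\<in>S. x v / ?n) ^ k \<le> (\<Sum>v\<in>S. x v ^ k / ?n)"
    using n assms False by (simp add: field_simps)
  then have "(\<Sum>v\<in>S. x v) ^ k / ?n ^ k \<le> (\<Sum>v\<in>S. x v ^ k) / ?n"
    by (simp add: power_divide flip: sum_divide_distrib)
  moreover have "?n ^ k = ?n ^ (k - 1) * ?n"
    using \<open>k > 0\<close> by (metis power_minus_mult)
  ultimately show ?thesis
    using n by (simp add: field_simps)
qed (use assms in \<open>auto simp: power_0_left\<close>)

declare finite_imp_finite_nsets [simp]

lemma card_nsets:
  assumes "finite S"
  shows "card (nsets S j) = card S choose j"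
proof -
  have "nsets S j = {T. T \<subseteq> S \<and> card T = j}"
    using assms by (auto simp: nsets_def intro: finite_subset)
  then show ?thesis using n_subsets[OF assms] by simp
qed

lemma card_nsets_member:
  assumes "finite S" "u \<in> S" "j > 0"
  shows "card {T \<in> nsets S j. u \<in> T} = (card S - 1) choose (j - 1)"
proof -
  have "bij_betw (insert u) (nsets (S - {u}) (j - 1)) {T \<in> nsets S j. u \<in> T}"
  proof (rule bij_betw_byWitness[where f' = "\<lambda>T. T - {u}"])
    show "insert u ` nsets (S - {u}) (j - 1) \<subseteq> {T \<in> nsets S j. u \<in> T}"
    proof
      fix T assume "T \<in> insert u ` nsets (S - {u}) (j - 1)"
      then obtain T' where "T = insert u T'" "T' \<subseteq> S - {u}" "finite T'" "card T' = j - 1"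
        by (auto simp: nsets_def)
      moreover from this have "u \<notin> T'" by auto
      ultimately show "T \<in> {T \<in> nsets S j. u \<in> T}" 
        using assms by (auto simp: nsets_def)
    qed
  qed (use assms in \<open>auto simp: nsets_def\<close>)
  then have "card {T \<in> nsets S j. u \<in> T} = card (nsets (S - {u}) (j - 1))"
    by (metis bij_betw_same_card)
  also have "\<dots> = (card S - 1) choose (j - 1)"
    using assms by (simp add: card_nsets)
  finally show ?thesis .
qed

lemma sum_nsets_sum:
  fixes g :: "'a \<Rightarrow> real"
  assumes "finite S" "j > 0"
  shows "(\<Sum>T\<in>nsets S j. \<Sum>u\<in>T. g u) = real ((card S - 1) choose (j - 1)) * (\<Sum>u\<in>S. g u)"
proof -
  have "(\<Sum>T\<in>nsets S j. \<Sum>u\<in>T. g u) = (\<Sum>T\<in>nsets S j. \<Sum>u\<in>S. if u \<in> T then g u else 0)"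
  proof (rule sum.cong[OF refl])
    fix T assume "T \<in> nsets S j"
    then have "T \<subseteq> S" by (simp add: nsets_def)
    then show "(\<Sum>u\<in>T. g u) = (\<Sum>u\<in>S. if u \<in> T then g u else 0)"
      using assms(1) by (simp add: sum.If_cases Int_absorb1 inf_commute Int_def[symmetric] flip: sum.inter_filter)
        
  qed
  also have "\<dots> = (\<Sum>u\<in>S. \<Sum>T\<in>nsets S j. if u \<in> T then g u else 0)"
    by (rule sum.swap)
  also have "\<dots> = (\<Sum>u\<in>S. real ((card S - 1) choose (j - 1)) * g u)"
  proof (rule sum.cong[OF refl])
    fix u assume u: "u \<in> S"
    have "(\<Sum>T\<in>nsets S j. if u \<in> T then g u else 0) = (\<Sum>T\<in>{T \<in> nsets S j. u \<in> T}. g u)"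
      using assms(1) by (intro sum.inter_filter[symmetric]) simp
    also have "\<dots> = real ((card S - 1) choose (j - 1)) * g u"
      using card_nsets_member[OF assms(1) u assms(2)] by simp
    finally show "(\<Sum>T\<in>nsets S j. if u \<in> T then g u else 0) = real ((card S - 1) choose (j - 1)) * g u" .
  qed
  finally show ?thesis by (simp add: sum_distrib_left)
qed

lemma esym_nonneg: "(\<And>v. v \<in> S \<Longrightarrow> 0 \<le> x v) \<Longrightarrow> 0 \<le> esym j x S"
  unfolding esym_def by (intro sum_nonneg prod_nonneg) (auto simp: nsets_def)

lemma esym_mono:
  assumes "finite S" "S' \<subseteq> S" "\<And>v. v \<in> S \<Longrightarrow> 0 \<le> x v"
  shows "esym j x S' \<le> esym j x S"
  unfolding esym_def using assms
  by (intro sum_mono2 prod_nonneg) (auto simp: nsets_def)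

lemma esym_le_pow2:
  assumes "finite S" "\<And>v. v \<in> S \<Longrightarrow> 0 \<le> x v" "\<And>v. v \<in> S \<Longrightarrow> x v \<le> 1"
  shows "esym j x S \<le> 2 ^ card S"
proof -
  have "esym j x S \<le> (\<Sum>T\<in>nsets S j. 1)"
    unfolding esym_def by (intro sum_mono prod_le_1) (use assms in \<open>auto simp: nsets_def\<close>)
  also have "\<dots> \<le> real (card (Pow S))"
    using assms card_mono[of "Pow S" "nsets S j"] by (auto simp: nsets_def)
  finally show ?thesis using assms by (simp add: card_Pow)
qed

text \<open>AM-GM on each \<open>k\<close>-subset, then double counting of the subsets through a
  vertex. Constant \<open>x\<close> gives equality; for \<open>card S = a\<close> the coefficient is
  the lower end of the interval that contains the spectral radius.\<close>

lemma esym_self_le: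
  assumes "finite S" "k > 0" "\<And>v. v \<in> S \<Longrightarrow> 0 \<le> x v"
  shows "real k * esym k x S \<le> real ((card S - 1) choose (k - 1)) * (\<Sum>v\<in>S. x v ^ k)"
proof -
  have "real k * esym k x S = (\<Sum>T\<in>nsets S k. real k * (\<Prod>v\<in>T. x v))"
    by (simp add: esym_def sum_distrib_left)
  also have "\<dots> \<le> (\<Sum>T\<in>nsets S k. \<Sum>v\<in>T. x v ^ k)"
  proof (rule sum_mono)
    fix T assume "T \<in> nsets S k"
    then have T: "T \<subseteq> S" "finite T" "card T = k" by (auto simp: nsets_def)
    then have "T \<noteq> {}" using assms by auto
    then show "real k * (\<Prod>v\<in>T. x v) \<le> (\<Sum>v\<in>T. x v ^ k)"
      using prod_le_sum_powers[of T x] T assms by auto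
  qed
  finally show ?thesis using sum_nsets_sum[OF assms(1,2)] by simp
qed

text \<open>AM-GM on the \<open>k\<close> numbers formed by the entries of a (k-1)-subset and
  \<open>\<theta> * y\<close>. The free scale \<theta> makes the bound sharp at vectors whose
  entries on \<open>S\<close> all equal \<open>\<theta> * y\<close>; each application below picks
  the ratio of its own extremal vector.\<close>

lemma esym_mult_le:
  fixes x :: "'a \<Rightarrow> real"
  assumes "finite S" "k \<ge> 2" "\<And>v. v \<in> S \<Longrightarrow> 0 \<le> x v" "0 \<le> y" "0 \<le> \<theta>"
  shows "real k * \<theta> * esym (k - 1) x S * y
    \<le> real ((card S - 1) choose (k - 2)) * (\<Sum>v\<in>S. x v ^ k)
      + real (card S choose (k - 1)) * \<theta> ^ k * y ^ k"
proof -
  have "real k * \<theta> * esym (k - 1) x S * y = (\<Sum>T\<in>nsets S (k-1). real k * ((\<theta> * y) * (\<Prod>v\<in>T. x v)))"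
    by (simp add: esym_def sum_distrib_left sum_distrib_right algebra_simps)
  also have "\<dots> \<le> (\<Sum>T\<in>nsets S (k-1). (\<Sum>v\<in>T. x v ^ k) + (\<theta> * y) ^ k)"
  proof (rule sum_mono)
    fix T assume "T \<in> nsets S (k-1)"
    then have T: "T \<subseteq> S" "finite T" "card T = k - 1" by (auto simp: nsets_def)
    \<comment> \<open>The extra factor becomes the entry of a new point \<open>None\<close>, so that
      AM-GM for sets applies to \<open>k\<close> points.\<close>
    let ?z = "case_option (\<theta> * y) x"
    let ?U = "insert None (Some ` T)"
    have c: "card ?U = k" using T assms by (simp add: card_image)
    have "real (card ?U) * (\<Prod>v\<in>?U. ?z v) \<le> (\<Sum>v\<in>?U. ?z v ^ card ?U)"
      by (rule prod_le_sum_powers) (use T assms in auto)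
    moreover have "(\<Prod>v\<in>?U. ?z v) = (\<theta> * y) * (\<Prod>v\<in>T. x v)"
      using T by (simp add: prod.reindex)
    moreover have "(\<Sum>v\<in>?U. ?z v ^ k) = (\<theta> * y) ^ k + (\<Sum>v\<in>T. x v ^ k)"
      using T by (simp add: sum.reindex)
    ultimately show "real k * ((\<theta> * y) * (\<Prod>v\<in>T. x v)) \<le> (\<Sum>v\<in>T. x v ^ k) + (\<theta> * y) ^ k"
      unfolding c by simp
  qed
  also have "\<dots> = real ((card S - 1) choose (k - 2)) * (\<Sum>v\<in>S. x v ^ k)
      + real (card S choose (k - 1)) * \<theta> ^ k * y ^ k"
    using sum_nsets_sum[OF assms(1), of "k - 1" "\<lambda>v. x v ^ k"] assms
    by (simp add: sum.distrib card_nsets power_mult_distrib diff_diff_eq numeral_2_eq_2)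
  finally show ?thesis .
qed

text \<open>A union bound: each edge is charged to one of its vertices \<open>v\<close>, with the
  rest of the edge among the sets allowed at \<open>v\<close>. Pairs that arise from no edge only
  add nonnegative terms. Elimination orders enter the estimates in this form.\<close>

lemma sum_prod_cover_le:
  fixes x :: "'a \<Rightarrow> real"
  assumes "finite I" "\<And>v. v \<in> I \<Longrightarrow> finite (\<T> v)" "\<And>F. F \<in> E \<Longrightarrow> finite F" "finite E"
    and cov: "\<And>F. F \<in> E \<Longrightarrow> \<exists>v\<in>F \<inter> I. F - {v} \<in> \<T> v"
    and nn: "\<And>v. v \<in> I \<Longrightarrow> 0 \<le> x v" "\<And>v T u. v \<in> I \<Longrightarrow> T \<in> \<T> v \<Longrightarrow> u \<in> T \<Longrightarrow> 0 \<le> x u"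
  shows "(\<Sum>F\<in>E. \<Prod>u\<in>F. x u) \<le> (\<Sum>v\<in>I. x v * (\<Sum>T\<in>\<T> v. \<Prod>u\<in>T. x u))"
proof -
  have "(\<Sum>F\<in>E. \<Prod>u\<in>F. x u) \<le> (\<Sum>(v,T)\<in>Sigma I \<T>. x v * (\<Prod>u\<in>T. x u))"
  proof (rule sum_le_included[where i = "\<lambda>(v,T). insert v T"])
    show "\<forall>F\<in>E. \<exists>y\<in>Sigma I \<T>. (case y of (v, T) \<Rightarrow> insert v T) = F \<and>
        (\<Prod>u\<in>F. x u) \<le> (case y of (v, T) \<Rightarrow> x v * (\<Prod>u\<in>T. x u))"
    proof
      fix F assume F: "F \<in> E"
      with cov obtain v where v: "v \<in> F" "v \<in> I" "F - {v} \<in> \<T> v" by blast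
      have "(\<Prod>u\<in>F. x u) = x v * (\<Prod>u\<in>F-{v}. x u)"
        using assms(3)[OF F] v by (simp add: prod.remove)
      with v show "\<exists>y\<in>Sigma I \<T>. (case y of (v, T) \<Rightarrow> insert v T) = F \<and>
        (\<Prod>u\<in>F. x u) \<le> (case y of (v, T) \<Rightarrow> x v * (\<Prod>u\<in>T. x u))"
        by (intro bexI[of _ "(v, F - {v})"]) auto
    qed
  qed (use assms in \<open>auto intro!: mult_nonneg_nonneg prod_nonneg\<close>)
  also have "\<dots> = (\<Sum>v\<in>I. \<Sum>T\<in>\<T> v. x v * (\<Prod>u\<in>T. x u))"
    using assms by (simp add: sum.Sigma)
  finally show ?thesis by (simp add: sum_distrib_left)
qed

section \<open>Complete minors\<close>

text \<open>Branch sets are confined to \<open>W\<close> instead of living in an induced subgraph,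
  so that inductions over vertex sets keep one fixed \<open>G\<close>.\<close>

definition clique_minor_in :: "'a graph \<Rightarrow> 'a set \<Rightarrow> nat \<Rightarrow> bool" where
  "clique_minor_in G W t \<longleftrightarrow>
     (\<exists>\<beta> :: nat \<Rightarrow> 'a set. (\<forall>i<t. \<beta> i \<subseteq> W \<and> connected_in G (\<beta> i)) \<and>
        (\<forall>i<t. \<forall>j<t. i \<noteq> j \<longrightarrow> \<beta> i \<inter> \<beta> j = {} \<and> (\<exists>x\<in>\<beta> i. \<exists>y\<in>\<beta> j. {x, y} \<in> edges G)))"

lemma has_minor_complete_graph:
  assumes "clique_minor_in G (vertices G) t"
  shows "has_minor G (complete_graph t)"
proof -
  from assms obtain \<beta> :: "nat \<Rightarrow> 'a set"
    where 1: "\<forall>i<t. \<beta> i \<subseteq> vertices G \<and> connected_in G (\<beta> i)"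
    and 2: "\<forall>i<t. \<forall>j<t. i \<noteq> j \<longrightarrow>
      \<beta> i \<inter> \<beta> j = {} \<and> (\<exists>x\<in>\<beta> i. \<exists>y\<in>\<beta> j. {x, y} \<in> edges G)"
    unfolding clique_minor_in_def by (elim exE conjE) (rule that)
  show ?thesis
    unfolding has_minor_def
  proof (intro exI[of _ \<beta>] conjI ballI impI)
    fix u v assume "u \<in> vertices (complete_graph t)" "v \<in> vertices (complete_graph t)"
      "{u, v} \<in> edges (complete_graph t)"
    then have "u < t" "v < t" "u \<noteq> v" by (simp_all add: complete_graph_def)
    then show "\<exists>x\<in>\<beta> u. \<exists>y\<in>\<beta> v. {x, y} \<in> edges G" using 2 by simp
  qed (use 1 2 in \<open>simp_all add: complete_graph_def\<close>)
qed

lemma clique_minor_in_mono: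
  assumes "clique_minor_in G W t" "W \<subseteq> W'"
  shows "clique_minor_in G W' t"
proof -
  from assms(1) obtain \<beta> :: "nat \<Rightarrow> 'a set"
    where \<beta>: "\<forall>i<t. \<beta> i \<subseteq> W \<and> connected_in G (\<beta> i)"
      "\<forall>i<t. \<forall>j<t. i \<noteq> j \<longrightarrow>
        \<beta> i \<inter> \<beta> j = {} \<and> (\<exists>x\<in>\<beta> i. \<exists>y\<in>\<beta> j. {x, y} \<in> edges G)"
    unfolding clique_minor_in_def by (elim exE conjE) (rule that)
  have "\<forall>i<t. \<beta> i \<subseteq> W' \<and> connected_in G (\<beta> i)"
    using \<beta>(1) assms(2) by blast
  with \<beta>(2) show ?thesis
    unfolding clique_minor_in_def by (intro exI[of _ \<beta>] conjI)
qed

lemma connected_in_singleton: "connected_in G {v}"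
  by (simp add: connected_in_def)

lemma connected_in_insert:
  assumes "connected_in G U" "u \<in> U" "{u, v} \<in> edges G"
  shows "connected_in G (insert v U)"
proof -
  define R where "R S = {(u, v). u \<in> S \<and> v \<in> S \<and> {u, v} \<in> edges G}" for S
  let ?U = "insert v U"
  have "R U \<subseteq> R ?U" by (auto simp: R_def)
  then have mono: "(R U)\<^sup>* \<subseteq> (R ?U)\<^sup>*" by (rule rtrancl_mono)
  have "(u, v) \<in> R ?U" "(v, u) \<in> R ?U"
    using assms by (auto simp: R_def insert_commute)
  moreover have "(x, y) \<in> (R U)\<^sup>*" if "x \<in> U" "y \<in> U" for x y
    using assms(1) that by (auto simp: connected_in_def R_def)
  ultimately have "(x, u) \<in> (R ?U)\<^sup>*" "(u, x) \<in> (R ?U)\<^sup>*" if "x \<in> ?U" for x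
    using that mono assms(2) by auto
  then have "(x, y) \<in> (R ?U)\<^sup>*" if "x \<in> ?U" "y \<in> ?U" for x y
    using that by (meson rtrancl_trans)
  then show ?thesis
    by (auto simp: connected_in_def R_def)
qed

section \<open>Average degree, elimination orders and clique minors\<close>

definition degree_in :: "'a graph \<Rightarrow> 'a set \<Rightarrow> 'a \<Rightarrow> nat" where
  "degree_in G W v = card {u \<in> W. {v, u} \<in> edges G}"

text \<open>For a loopless \<open>G\<close> this is twice the number of edges inside
  \<open>W\<close>.\<close>

definition degree_sum :: "'a graph \<Rightarrow> 'a set \<Rightarrow> nat" where
  "degree_sum G W = (\<Sum>v\<in>W. degree_in G W v)"

lemma degree_sum_remove:
  assumes "finite W" "v \<in> W" "{v} \<notin> edges G"
  shows "degree_sum G W = degree_sum G (W - {v}) + 2 * degree_in G W v"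
proof -
  have "degree_in G W u = degree_in G (W - {v}) u + of_bool ({v, u} \<in> edges G)"
    if "u \<in> W - {v}" for u
  proof (cases "{v, u} \<in> edges G")
    case True
    then have "{w \<in> W. {u, w} \<in> edges G} = insert v {w \<in> W - {v}. {u, w} \<in> edges G}"
      using assms by (auto simp: insert_commute)
    then show ?thesis using True assms by (simp add: degree_in_def)
  next
    case False
    then have "{w \<in> W. {u, w} \<in> edges G} = {w \<in> W - {v}. {u, w} \<in> edges G}"
      by (auto simp: insert_commute)
    then show ?thesis using False by (simp add: degree_in_def)
  qed
  then have "(\<Sum>u\<in>W-{v}. degree_in G W u)
      = degree_sum G (W - {v}) + (\<Sum>u\<in>W-{v}. of_bool ({v, u} \<in> edges G))"
    by (simp add: degree_sum_def sum.distrib)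
  also have "(\<Sum>u\<in>W-{v}. of_bool ({v, u} \<in> edges G)) = card {u \<in> W - {v}. {v, u} \<in> edges G}"
    using assms(1) by (subst sum_of_bool_eq) (auto intro: arg_cong[where f = card])
  also have "{u \<in> W - {v}. {v, u} \<in> edges G} = {u \<in> W. {v, u} \<in> edges G}"
    using assms by auto
  finally show ?thesis
    using assms by (simp add: degree_sum_def degree_in_def sum.remove[of W v])
qed

text \<open>Mader's theorem: a maximal connected set \<open>U\<close> whose contraction keeps the average degree large
  has a neighbourhood of large minimum degree, and \<open>U\<close> extends a smaller clique minor found there.\<close>

lemma degree_sum_imp_clique_minor:
  assumes "finite W" "W \<noteq> {}" "2 ^ (t + 1) * card W \<le> degree_sum G W" "\<And>v. {v} \<notin> edges G"
  shows "clique_minor_in G W t"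
  using assms(1-3)
proof (induction t arbitrary: W)
  case 0
  then show ?case by (simp add: clique_minor_in_def)
next
  case (Suc t)
  note outer = Suc.IH
  \<comment> \<open>The average degree for \<open>Suc t\<close> is at least \<open>2 * c\<close>.
    Half of it is retained as minimum degree in a neighbourhood, and \<open>c\<close> is exactly
    what the hypothesis for \<open>t\<close> requires; hence the powers of two.\<close>
  define c :: nat where "c = 2 ^ (t + 1)"
  from Suc.prems show ?case
  proof (induction W rule: finite_psubset_induct)
    case (psubset W)
    define N where "N U = {w \<in> W - U. \<exists>u\<in>U. {u, w} \<in> edges G}" for U
    \<comment> \<open>Contracting \<open>U\<close> to a point leaves \<open>card (W - U) + 1\<close>
      vertices and the degree sum on the right, the new point being adjacent to \<open>N U\<close>.
      So \<open>good\<close> says that the contracted graph still has average degree at least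
      \<open>2 * c\<close>.\<close>
    define good where "good U \<longleftrightarrow> U \<subseteq> W \<and> connected_in G U \<and>
      2 * c * (card (W - U) + 1) \<le> degree_sum G (W - U) + 2 * card (N U)" for U
    have arcs: "2 * c * card W \<le> degree_sum G W" using psubset.prems by (simp add: c_def)
    obtain u where u: "u \<in> W" using psubset.prems by blast
    have "good {u}"
    proof -
      have "card W = card (W - {u}) + 1"
        using u psubset.hyps by (metis card_Suc_Diff1 Suc_eq_plus1)
      moreover have "N {u} = {w \<in> W. {u, w} \<in> edges G}"
        using assms(4) by (auto simp: N_def)
      ultimately show ?thesis
        using arcs degree_sum_remove[OF psubset.hyps u assms(4)] u
        by (simp add: good_def connected_in_singleton degree_in_def)
    qed
    moreover have "\<forall>U. good U \<longrightarrow> card U < card W + 1"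
      using psubset.hyps by (auto simp: good_def less_Suc_eq_le intro: card_mono)
    ultimately obtain U where U: "good U" and max: "\<And>U'. good U' \<Longrightarrow> card U' \<le> card U"
      using ex_has_greatest_nat[of good "{u}" card "card W + 1"] by blast
    have UW: "U \<subseteq> W" and conU: "connected_in G U" using U by (auto simp: good_def)
    have finU: "finite U" using UW psubset.hyps finite_subset by blast
    have neU: "U \<noteq> {}" using conU by (auto simp: connected_in_def)
    have finN: "finite (N U)" using psubset.hyps by (simp add: N_def)
    show ?case
    proof (cases "N U = {}")
      case True
      \<comment> \<open>No edge leaves \<open>U\<close>, so the rest alone is at least as dense and
        the inner induction applies to it.\<close>
      with U have *: "2 * c * (card (W - U) + 1) \<le> degree_sum G (W - U)" by (simp add: good_def)
      moreover have "W - U \<noteq> {}"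
      proof
        assume "W - U = {}"
        with * show False by (simp add: degree_sum_def c_def)
      qed
      ultimately have "clique_minor_in G (W - U) (Suc t)"
        using psubset.hyps neU UW by (intro psubset.IH) (auto simp: c_def)
      then show ?thesis by (rule clique_minor_in_mono) auto
    next
      case False
      \<comment> \<open>If \<open>v\<close> has fewer than \<open>c\<close> neighbours in
        \<open>N U\<close>, absorbing it into \<open>U\<close> removes one vertex and at most
        \<open>c\<close> edges: the one to the contracted point and those that become parallel. The
        result is still good, against the maximality of \<open>U\<close>.\<close>
      have "c \<le> degree_in G (N U) v" if v: "v \<in> N U" for v
      proof (rule ccontr)
        assume *: "\<not> c \<le> degree_in G (N U) v"
        obtain u where u: "u \<in> U" "{u, v} \<in> edges G" using v by (auto simp: N_def)
        have vW: "v \<in> W - U" using v by (auto simp: N_def)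
        let ?U = "insert v U"
        have eq: "W - ?U = (W - U) - {v}" by auto
        have cW: "card (W - U) = card (W - ?U) + 1"
          unfolding eq using vW psubset.hyps by (metis card_Suc_Diff1 Suc_eq_plus1 finite_Diff)
        have ds: "degree_sum G (W - U) = degree_sum G (W - ?U) + 2 * degree_in G (W - U) v"
          unfolding eq using psubset.hyps vW assms(4) by (intro degree_sum_remove) auto
        have NU: "N ?U = (N U - {v}) \<union> {w \<in> W - U. {v, w} \<in> edges G \<and> w \<notin> N U}"
          using assms(4) v by (auto simp: N_def)
        have cN: "card (N ?U) = (card (N U) - 1) + card {w \<in> W - U. {v, w} \<in> edges G \<and> w \<notin> N U}"
          unfolding NU using psubset.hyps finN v by (subst card_Un_disjoint) auto
        have "{w \<in> W - U. {v, w} \<in> edges G} = {w \<in> N U. {v, w} \<in> edges G} \<union>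
            {w \<in> W - U. {v, w} \<in> edges G \<and> w \<notin> N U}"
          by (auto simp: N_def)
        then have cd: "degree_in G (W - U) v = degree_in G (N U) v +
            card {w \<in> W - U. {v, w} \<in> edges G \<and> w \<notin> N U}"
          unfolding degree_in_def using psubset.hyps finN
          by (simp, subst card_Un_disjoint) auto
        have "card (N U) > 0" using v finN by (auto simp: card_gt_0_iff)
        moreover have "2 * c * (card (W - U) + 1) \<le> degree_sum G (W - U) + 2 * card (N U)"
          using U by (simp add: good_def)
        ultimately have "2 * c * (card (W - ?U) + 1) \<le> degree_sum G (W - ?U) + 2 * card (N ?U)"
          using * unfolding ds cN cd cW by (simp add: algebra_simps)
        then have "good ?U"
          using UW vW connected_in_insert[OF conU u] by (auto simp: good_def)
        from max[OF this] show False using vW finU by simp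
      qed
      then have "(\<Sum>v\<in>N U. c) \<le> degree_sum G (N U)"
        unfolding degree_sum_def by (intro sum_mono) auto
      then have "clique_minor_in G (N U) t"
        using finN False by (intro outer) (auto simp: c_def mult.commute)
      then obtain \<beta> where \<beta>: "\<forall>i<t. \<beta> i \<subseteq> N U \<and> connected_in G (\<beta> i)"
        "\<forall>i<t. \<forall>j<t. i \<noteq> j \<longrightarrow> \<beta> i \<inter> \<beta> j = {} \<and> (\<exists>x\<in>\<beta> i. \<exists>y\<in>\<beta> j. {x, y} \<in> edges G)"
        unfolding clique_minor_in_def by blast
      have adj: "\<beta> i \<inter> U = {} \<and> (\<exists>x\<in>\<beta> i. \<exists>y\<in>U. {x, y} \<in> edges G)" if "i < t" for i
      proof -
        have sub: "\<beta> i \<subseteq> N U" and "\<beta> i \<noteq> {}"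
          using \<beta>(1) that by (auto simp: connected_in_def)
        then obtain x where x: "x \<in> \<beta> i" "x \<in> N U" by blast
        then obtain y where "y \<in> U" "{y, x} \<in> edges G" by (auto simp: N_def)
        then show ?thesis using x sub by (auto simp: N_def insert_commute)
      qed
      have "(\<forall>i<Suc t. (\<beta>(t := U)) i \<subseteq> W \<and> connected_in G ((\<beta>(t := U)) i))"
        using \<beta>(1) UW conU by (auto simp: less_Suc_eq N_def)
      moreover have "\<forall>i<Suc t. \<forall>j<Suc t. i \<noteq> j \<longrightarrow> (\<beta>(t := U)) i \<inter> (\<beta>(t := U)) j = {} \<and>
          (\<exists>x\<in>(\<beta>(t := U)) i. \<exists>y\<in>(\<beta>(t := U)) j. {x, y} \<in> edges G)"
      proof (intro allI impI)
        fix i j assume ij: "i < Suc t" "j < Suc t" "i \<noteq> j"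
        consider "i < t" "j < t" | "i < t" "j = t" | "i = t" "j < t"
          using ij by linarith
        then show "(\<beta>(t := U)) i \<inter> (\<beta>(t := U)) j = {} \<and>
          (\<exists>x\<in>(\<beta>(t := U)) i. \<exists>y\<in>(\<beta>(t := U)) j. {x, y} \<in> edges G)"
        proof cases
          case 1
          then show ?thesis using \<beta>(2) ij by simp
        next
          case 2
          then show ?thesis using adj[of i] by simp
        next
          case 3
          then show ?thesis using adj[of j] by (simp add: Int_commute) (metis insert_commute)
        qed
      qed
      ultimately show ?thesis
        unfolding clique_minor_in_def by blast
    qed
  qed
qed

text \<open>A form of degeneracy: each clique lies in \<open>insert v (B v)\<close> for its last vertex \<open>v\<close> in an
  elimination order.\<close>

lemma clique_minor_free_cover:
  assumes "finite V" "\<not> clique_minor_in G V t" "\<And>v. {v} \<notin> edges G"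
  shows "\<exists>B. (\<forall>v\<in>V. B v \<subseteq> V \<and> card (B v) \<le> 2 ^ (t + 1)) \<and>
    (\<forall>F\<subseteq>V. F \<noteq> {} \<and> clique F (edges G) \<longrightarrow> (\<exists>v\<in>F. F - {v} \<subseteq> B v))"
  using assms(1,2)
proof (induction V rule: finite_psubset_induct)
  case (psubset V)
  show ?case
  proof (cases "V = {}")
    case False
    have "\<exists>v\<in>V. degree_in G V v \<le> 2 ^ (t + 1)"
    proof (rule ccontr)
      assume "\<not> ?thesis"
      then have "(\<Sum>v\<in>V. 2 ^ (t + 1)) \<le> degree_sum G V"
        unfolding degree_sum_def by (intro sum_mono) force
      then have "clique_minor_in G V t"
        using psubset.hyps False assms(3)
        by (intro degree_sum_imp_clique_minor) (auto simp: mult.commute)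
      with psubset.prems show False by simp
    qed
    then obtain v where v: "v \<in> V" "degree_in G V v \<le> 2 ^ (t + 1)" by blast
    have "V - {v} \<subset> V" "\<not> clique_minor_in G (V - {v}) t"
      using psubset.prems clique_minor_in_mono[of G "V - {v}" t V] v by blast+
    from psubset.IH[OF this] obtain B where "\<forall>w\<in>V - {v}. B w \<subseteq> V - {v} \<and> card (B w) \<le> 2 ^ (t + 1)"
      "\<forall>F\<subseteq>V - {v}. F \<noteq> {} \<and> clique F (edges G) \<longrightarrow> (\<exists>w\<in>F. F - {w} \<subseteq> B w)"
      by (elim exE conjE) (rule that)
    then have B: "\<And>w. w \<in> V - {v} \<Longrightarrow> B w \<subseteq> V - {v} \<and> card (B w) \<le> 2 ^ (t + 1)"
      "\<And>F. F \<subseteq> V - {v} \<Longrightarrow> F \<noteq> {} \<Longrightarrow> clique F (edges G) \<Longrightarrow> \<exists>w\<in>F. F - {w} \<subseteq> B w"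
      by simp_all
    \<comment> \<open>Every clique through the low-degree vertex \<open>v\<close> is charged to
      \<open>v\<close>; the others are charged within \<open>V - {v}\<close>.\<close>
    define B' where "B' = B(v := {u \<in> V. {v, u} \<in> edges G})"
    have "B' w \<subseteq> V \<and> card (B' w) \<le> 2 ^ (t + 1)" if "w \<in> V" for w
      using B(1)[of w] v that by (auto simp: B'_def degree_in_def)
    moreover have "\<exists>w\<in>F. F - {w} \<subseteq> B' w" if F: "F \<subseteq> V" "F \<noteq> {}" "clique F (edges G)" for F
    proof (cases "v \<in> F")
      case True
      then have "F - {v} \<subseteq> B' v" using F by (auto simp: B'_def clique_def)
      with True show ?thesis by blast
    next
      case False
      then obtain w where "w \<in> F" "F - {w} \<subseteq> B w" using B(2)[of F] F by blast
      then show ?thesis using False by (intro bexI[of _ w]) (auto simp: B'_def)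
    qed
    ultimately show ?thesis by blast
  qed simp
qed

text \<open>Contracting a matching between \<open>A\<close> and \<open>P\<close> turns \<open>A\<close> into a clique.\<close>

lemma clique_minor_of_matching:
  assumes fin: "finite A" "finite P" and card: "card A \<le> card P" and "A \<inter> P = {}"
    and AP: "\<And>u p. u \<in> A \<Longrightarrow> p \<in> P \<Longrightarrow> {u, p} \<in> edges G"
    and con: "connected_in G U" "connected_in G U'"
    and disj: "U \<inter> U' = {}" "U \<inter> (A \<union> P) = {}" "U' \<inter> (A \<union> P) = {}"
    and adj: "\<exists>x\<in>U. \<exists>y\<in>U'. {x, y} \<in> edges G"
      "\<And>u p. u \<in> A \<Longrightarrow> p \<in> P \<Longrightarrow> \<exists>z\<in>U. {z, u} \<in> edges G \<or> {z, p} \<in> edges G"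
      "\<And>u p. u \<in> A \<Longrightarrow> p \<in> P \<Longrightarrow> \<exists>z\<in>U'. {z, u} \<in> edges G \<or> {z, p} \<in> edges G"
    and sub: "A \<union> P \<union> U \<union> U' \<subseteq> V"
  shows "clique_minor_in G V (card A + 2)"
proof -
  let ?a = "card A"
  obtain f where f: "bij_betw f {..<?a} A"
    using fin ex_bij_betw_nat_finite[of A] by (auto simp: lessThan_atLeast0)
  obtain h where h: "inj_on h A" "h ` A \<subseteq> P"
    using inj_on_iff_card_le[OF fin] card by blast
  define g where "g = h \<circ> f"
  have fA: "f i \<in> A" if "i < ?a" for i using f that by (auto simp: bij_betw_def)
  have gP: "g i \<in> P" if "i < ?a" for i using fA[OF that] h by (auto simp: g_def)
  have finj: "f i \<noteq> f j" if "i < ?a" "j < ?a" "i \<noteq> j" for i j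
    using f that by (auto simp: bij_betw_def inj_on_def)
  have ginj: "g i \<noteq> g j" if "i < ?a" "j < ?a" "i \<noteq> j" for i j
    using h(1) fA that finj[OF that] by (auto simp: g_def inj_on_def)
  \<comment> \<open>Any injection from \<open>A\<close> into \<open>P\<close> gives a matching. Two
    matched pairs are joined by the edge from \<open>f i\<close> to \<open>g j\<close>, so no edges
    inside \<open>A\<close> or inside \<open>P\<close> are required.\<close>
  define \<beta> where "\<beta> i = (if i < ?a then {f i, g i} else if i = ?a then U else U')" for i
  have 1: "\<beta> i \<subseteq> V \<and> connected_in G (\<beta> i)" if "i < ?a + 2" for i
  proof (cases "i < ?a")
    case True
    have "connected_in G (insert (g i) {f i})"
      by (rule connected_in_insert[OF connected_in_singleton, of "f i"])
        (use AP fA[OF True] gP[OF True] in auto)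
    then show ?thesis using True fA[OF True] gP[OF True] sub
      by (auto simp: \<beta>_def insert_commute)
  qed (use con sub in \<open>auto simp: \<beta>_def\<close>)
  have 2: "\<beta> i \<inter> \<beta> j = {} \<and> (\<exists>x\<in>\<beta> i. \<exists>y\<in>\<beta> j. {x, y} \<in> edges G)" if "i < j" "j < ?a + 2" for i j
  proof -
    consider "j < ?a" | "i < ?a" "j = ?a" | "i < ?a" "j = ?a + 1" | "i = ?a" "j = ?a + 1"
      using \<open>i < j\<close> \<open>j < ?a + 2\<close> by linarith
    then show ?thesis
    proof cases
      case 1
      then have "i < ?a" "j < ?a" "i \<noteq> j" using that by auto
      note fA[OF this(1)] fA[OF this(2)] gP[OF this(1)] gP[OF this(2)] finj[OF this] ginj[OF this]
      moreover from this have "f i \<noteq> g j" "g i \<noteq> f j" using assms(4) by auto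
      ultimately show ?thesis using \<open>i < ?a\<close> \<open>j < ?a\<close> AP[of "f i" "g j"]
        by (auto simp: \<beta>_def)
    next
      case 2
      then obtain z where "z \<in> U" "{z, f i} \<in> edges G \<or> {z, g i} \<in> edges G"
        using adj(2) fA gP by blast
      then show ?thesis using 2 fA[of i] gP[of i] disj
        by (auto simp: \<beta>_def insert_commute)
    next
      case 3
      then obtain z where "z \<in> U'" "{z, f i} \<in> edges G \<or> {z, g i} \<in> edges G"
        using adj(3) fA gP by blast
      then show ?thesis using 3 fA[of i] gP[of i] disj
        by (auto simp: \<beta>_def insert_commute)
    next
      case 4
      then show ?thesis using disj adj(1) by (auto simp: \<beta>_def)
    qed
  qed
  have 3: "\<beta> i \<inter> \<beta> j = {} \<and> (\<exists>x\<in>\<beta> i. \<exists>y\<in>\<beta> j. {x, y} \<in> edges G)"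
    if "i < ?a + 2" "j < ?a + 2" "i \<noteq> j" for i j
  proof (cases "i < j")
    case False
    then have "\<beta> j \<inter> \<beta> i = {} \<and> (\<exists>x\<in>\<beta> j. \<exists>y\<in>\<beta> i. {x, y} \<in> edges G)" using that by (intro 2) auto
    then show ?thesis by (metis Int_commute insert_commute)
  qed (use that 2 in simp)
  from 1 3 show ?thesis unfolding clique_minor_in_def by blast
qed

text \<open>The \<open>k\<close>-cliques of the join of a complete graph on \<open>A\<close> with an
  edgeless graph on \<open>N\<close>. Stated for subsets of any type, it describes B and also its
  candidate copies inside another hypergraph.\<close>

definition split_edges :: "nat \<Rightarrow> 'a set \<Rightarrow> 'a set \<Rightarrow> 'a set set" where
  "split_edges k A N = {F \<in> nsets (A \<union> N) k. \<forall>u\<in>F \<inter> N. \<forall>v\<in>F \<inter> N. u = v}"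

lemma vertices_B_hypergraph:
  "vertices (B_hypergraph k n t) = Inl ` {..<t - 2} \<union> Inr ` {..<n - (t - 2)}"
  by (auto simp: B_hypergraph_def clique_hypergraph_def graph_join_def complete_graph_def
      graph_complement_def Plus_def)

lemma edges_B_hypergraph:
  "edges (B_hypergraph k n t) = split_edges k (Inl ` {..<t - 2}) (Inr ` {..<n - (t - 2)})"
proof -
  let ?A = "Inl ` {..<t - 2} :: (nat + nat) set" and ?N = "Inr ` {..<n - (t - 2)} :: (nat + nat) set"
  define G where "G = graph_join (complete_graph (t - 2)) (graph_complement (complete_graph (n - (t - 2))))"
  have adj: "{u, v} \<in> edges G \<longleftrightarrow> u \<noteq> v \<and> \<not> (u \<in> ?N \<and> v \<in> ?N)" if "u \<in> ?A \<union> ?N" "v \<in> ?A \<union> ?N" for u v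
  proof
    assume "{u, v} \<in> edges G"
    then consider e where "e \<in> nsets {..<t-2} 2" "{u, v} = Inl ` e"
      | i j where "{u, v} = {Inl i, Inr j}"
      by (auto simp: G_def graph_join_def complete_graph_def graph_complement_def)
    then show "u \<noteq> v \<and> \<not> (u \<in> ?N \<and> v \<in> ?N)"
    proof cases
      case 1
      then obtain i j where "e = {i, j}" "i \<noteq> j" by (auto elim: nsets2_E)
      with 1 show ?thesis by (auto simp: doubleton_eq_iff)
    next
      case 2
      then show ?thesis by (auto simp: doubleton_eq_iff)
    qed
  next
    assume *: "u \<noteq> v \<and> \<not> (u \<in> ?N \<and> v \<in> ?N)"
    have ll: "{Inl i, Inl j} \<in> edges G" if "i < t - 2" "j < t - 2" "i \<noteq> j" for i j
    proof -
      have "({Inl i, Inl j} :: (nat + nat) set) \<in> (`) Inl ` edges (complete_graph (t - 2))"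
        using that by (intro image_eqI[of _ _ "{i, j}"]) (auto simp: complete_graph_def)
      then show ?thesis by (simp add: G_def graph_join_def)
    qed
    have lr: "{Inl i, Inr j} \<in> edges G" if "i < t - 2" "j < n - (t - 2)" for i j
      using that unfolding G_def graph_join_def complete_graph_def graph_complement_def by auto
    show "{u, v} \<in> edges G"
    proof (cases u; cases v)
      fix i j assume "u = Inl i" "v = Inl j"
      then show ?thesis using * that by (auto intro: ll)
    next
      fix i j assume "u = Inl i" "v = Inr j"
      then show ?thesis using that by (auto intro: lr)
    next
      fix i j assume "u = Inr i" "v = Inl j"
      then show ?thesis using that by (auto simp: insert_commute intro: lr)
    next
      fix i j assume "u = Inr i" "v = Inr j"
      then show ?thesis using that * by auto
    qed
  qed
  have "edges (B_hypergraph k n t) = {S \<in> nsets (?A \<union> ?N) k. clique S (edges G)}"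
    using vertices_B_hypergraph[of k n t]
    by (simp add: B_hypergraph_def clique_hypergraph_def G_def)
  also have "\<dots> = split_edges k ?A ?N"
  proof -
    have "clique S (edges G) \<longleftrightarrow> (\<forall>u\<in>S \<inter> N. \<forall>v\<in>S \<inter> N. u = v)"
      if S: "S \<subseteq> ?A \<union> ?N" and N: "N = ?N" for S N
    proof -
      have "(u \<noteq> v \<longrightarrow> {u, v} \<in> edges G) = (u \<noteq> v \<longrightarrow> \<not> (u \<in> N \<and> v \<in> N))" if "u \<in> S" "v \<in> S" for u v
        using adj[of u v] that S N by blast
      then have "clique S (edges G) \<longleftrightarrow> (\<forall>u\<in>S. \<forall>v\<in>S. u \<noteq> v \<longrightarrow> \<not> (u \<in> N \<and> v \<in> N))"
        unfolding clique_def by simp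
      also have "\<dots> \<longleftrightarrow> (\<forall>u\<in>S \<inter> N. \<forall>v\<in>S \<inter> N. u = v)" by blast
      finally show ?thesis .
    qed
    from this[OF _ refl] show ?thesis unfolding split_edges_def by (intro Collect_cong) (simp add: nsets_def cong: conj_cong)
  qed
  finally show ?thesis .
qed

text \<open>A branch set that avoids \<open>?A\<close> is connected inside the independent set
  \<open>?N\<close>, hence a single point, and two such points are not adjacent. So at most one
  branch set avoids \<open>?A\<close>; the others are disjoint and meet it, which allows at most (t
  - 2) + 1 of them.\<close>

lemma B_hypergraph_in_class:
  assumes "t \<ge> 2" "n \<ge> t - 2"
  shows "B_hypergraph k n t \<in> minor_free_shadow_class k (complete_graph t) n"
proof -
  let ?H = "B_hypergraph k n t"
  let ?A = "Inl ` {..<t - 2} :: (nat + nat) set" and ?N = "Inr ` {..<n - (t - 2)} :: (nat + nat) set"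
  have "uniform_hypergraph k ?H"
    by (auto simp: uniform_hypergraph_def vertices_B_hypergraph edges_B_hypergraph split_edges_def)
  moreover have "card (vertices ?H) = n"
    unfolding vertices_B_hypergraph using assms
    by (subst card_Un_disjoint) (auto simp: card_image)
  moreover have "\<not> has_minor (shadow ?H) (complete_graph t)"
  proof
    assume "has_minor (shadow ?H) (complete_graph t)"
    then obtain \<beta> :: "nat \<Rightarrow> (nat + nat) set"
      where 1: "\<forall>u\<in>vertices (complete_graph t). \<beta> u \<subseteq> vertices (shadow ?H) \<and> connected_in (shadow ?H) (\<beta> u)"
        and 2: "\<forall>u\<in>vertices (complete_graph t). \<forall>v\<in>vertices (complete_graph t). u \<noteq> v \<longrightarrow> \<beta> u \<inter> \<beta> v = {}"
        and 3: "\<forall>u\<in>vertices (complete_graph t). \<forall>v\<in>vertices (complete_graph t).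
          {u, v} \<in> edges (complete_graph t) \<longrightarrow> (\<exists>x\<in>\<beta> u. \<exists>y\<in>\<beta> v. {x, y} \<in> edges (shadow ?H))"
      unfolding has_minor_def by (elim exE conjE) (rule that)
    have vs: "vertices (shadow ?H) = ?A \<union> ?N"
      by (simp add: shadow_def vertices_B_hypergraph)
    have \<beta>: "\<forall>i<t. \<beta> i \<subseteq> ?A \<union> ?N \<and> connected_in (shadow ?H) (\<beta> i)"
      "\<forall>i<t. \<forall>j<t. i \<noteq> j \<longrightarrow> \<beta> i \<inter> \<beta> j = {}"
      "\<forall>i<t. \<forall>j<t. i \<noteq> j \<longrightarrow> (\<exists>x\<in>\<beta> i. \<exists>y\<in>\<beta> j. {x, y} \<in> edges (shadow ?H))"
      using 1 2 3 unfolding vs by (simp_all add: complete_graph_def)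
    have indep: "{x, y} \<notin> edges (shadow ?H)" if "x \<in> ?N" "y \<in> ?N" for x y
    proof
      assume "{x, y} \<in> edges (shadow ?H)"
      then obtain u v F where *: "{x, y} = {u, v}" "u \<noteq> v" "F \<in> edges ?H" "{u, v} \<subseteq> F"
        by (auto simp: shadow_def)
      have "{u, v} \<subseteq> ?N" unfolding *(1)[symmetric] using that by blast
      then have "u \<in> F \<inter> ?N" "v \<in> F \<inter> ?N" using *(4) by simp_all
      moreover have "\<forall>u\<in>F \<inter> ?N. \<forall>v\<in>F \<inter> ?N. u = v"
        using *(3) by (simp add: edges_B_hypergraph split_edges_def)
      ultimately show False using *(2) by blast
    qed
    define I where "I = {i. i < t \<and> \<beta> i \<inter> ?A = {}}"
    have single: "\<exists>p. \<beta> i = {p} \<and> p \<in> ?N" if "i \<in> I" for i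
    proof -
      have con: "connected_in (shadow ?H) (\<beta> i)" and "\<beta> i \<subseteq> ?A \<union> ?N" "\<beta> i \<inter> ?A = {}"
        using \<beta>(1) that by (simp_all add: I_def)
      then have sub: "\<beta> i \<subseteq> ?N" by blast
      have empty: "{(u, v). u \<in> \<beta> i \<and> v \<in> \<beta> i \<and> {u, v} \<in> edges (shadow ?H)} = {}"
        using indep subsetD[OF sub] by blast
      have "\<forall>x\<in>\<beta> i. \<forall>y\<in>\<beta> i. x = y" "\<beta> i \<noteq> {}"
        using con unfolding connected_in_def empty by simp_all
      then obtain p where "\<beta> i = {p}" by blast
      with sub show ?thesis by simp
    qed
    have I1: "i = j" if ij: "i \<in> I" "j \<in> I" for i j
    proof (rule ccontr)
      assume "i \<noteq> j"
      moreover have "i < t" "j < t" using ij by (auto simp: I_def)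
      ultimately obtain x y where "x \<in> \<beta> i" "y \<in> \<beta> j" "{x, y} \<in> edges (shadow ?H)"
        using \<beta>(3) by blast
      moreover obtain p where "\<beta> i = {p}" "p \<in> ?N" using single[OF ij(1)] by (elim exE conjE) (rule that)
      moreover obtain q where "\<beta> j = {q}" "q \<in> ?N" using single[OF ij(2)] by (elim exE conjE) (rule that)
      ultimately show False using indep by simp
    qed
    have "\<forall>i\<in>{..<t} - I. \<exists>u. u \<in> \<beta> i \<inter> ?A"
      unfolding I_def by blast
    then obtain f where f: "\<And>i. i \<in> {..<t} - I \<Longrightarrow> f i \<in> \<beta> i \<inter> ?A" by metis
    have "inj_on f ({..<t} - I)"
    proof (rule inj_onI)
      fix i j assume ij: "i \<in> {..<t} - I" "j \<in> {..<t} - I" "f i = f j"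
      then have "f i \<in> \<beta> i \<inter> \<beta> j" using f[of i] f[of j] by simp
      then show "i = j" using ij \<beta>(2) by blast
    qed
    then have "card ({..<t} - I) \<le> card ?A"
      using f by (intro card_inj_on_le[of f]) auto
    moreover have "card I \<le> 1"
      using I1 by (subst One_nat_def, subst card_le_Suc0_iff_eq) (auto simp: I_def)
    moreover have "card ({..<t} - I) = t - card I"
      by (subst card_Diff_subset) (auto simp: I_def)
    ultimately show False using assms by (simp add: card_image)
  qed
  ultimately show ?thesis by (simp add: minor_free_shadow_class_def)
qed

section \<open>The spectral radius of the clique hypergraph\<close>

definition edge_weight :: "('a \<Rightarrow> real) \<Rightarrow> 'a set set \<Rightarrow> real" where
  "edge_weight x E = (\<Sum>F\<in>E. \<Prod>v\<in>F. x v)"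

lemma entry_le_1:
  fixes x :: "'a \<Rightarrow> real"
  assumes "finite V" "v \<in> V" "\<And>u. u \<in> V \<Longrightarrow> 0 \<le> x u" "(\<Sum>u\<in>V. x u ^ k) = 1" "k > 0"
  shows "x v \<le> 1"
proof -
  have "x v ^ k \<le> (\<Sum>u\<in>V. x u ^ k)"
    using assms(1-3) by (intro member_le_sum) auto
  then have "x v ^ k \<le> 1 ^ k" using assms(4) by simp
  then show ?thesis using assms(2,3,5) by (metis power_mono_iff zero_le_one)
qed

text \<open>\<open>GREATEST\<close> has a meaning only once the maximum is known to exist. The
  feasible vectors form a closed subset of a product of compact intervals, and the weight is a
  polynomial in finitely many coordinates.\<close>

lemma spectral_radius_attained:
  assumes H: "uniform_hypergraph k H" and k: "k > 0" and ne: "vertices H \<noteq> {}"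
  obtains x where "\<forall>v\<in>vertices H. 0 \<le> x v" "(\<Sum>v\<in>vertices H. x v ^ k) = 1"
    "spectral_radius k H = real k * edge_weight x (edges H)"
proof -
  let ?V = "vertices H"
  have fin: "finite ?V" using H by (simp add: uniform_hypergraph_def)
  have sub: "F \<subseteq> ?V" if "F \<in> edges H" for F
    using H that by (auto simp: uniform_hypergraph_def nsets_def)
  \<comment> \<open>Coordinates off the vertex set are pinned to 0 to make the product over the
    whole type compact; \<open>z\<close> below truncates an arbitrary competitor
    accordingly.\<close>
  define S where "S v = (if v \<in> ?V then {0..1::real} else {0})" for v
  define P where "P = PiE UNIV S"
  have "compactin (product_topology (\<lambda>_. euclidean) UNIV) P"
    unfolding P_def compactin_PiE by (auto simp: S_def)
  then have cP: "compact P"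
    by (simp add: euclidean_product_topology)
  let ?f = "\<lambda>x. real k * edge_weight x (edges H)"
  let ?g = "\<lambda>x :: 'a \<Rightarrow> real. \<Sum>v\<in>?V. x v ^ k"
  have coord: "continuous_on UNIV (\<lambda>x :: 'a \<Rightarrow> real. x v)" for v
    by (rule continuous_on_product_coordinates)
  have "closed {x. ?g x = 1}"
    by (intro closed_Collect_eq continuous_intros coord)
  with cP have cK: "compact (P \<inter> {x. ?g x = 1})"
    by (rule compact_Int_closed)
  obtain v0 where v0: "v0 \<in> ?V" using ne by blast
  have "(\<lambda>v. if v = v0 then 1 else 0) \<in> P \<inter> {x. ?g x = 1}"
  proof -
    have "(\<Sum>v\<in>?V. (if v = v0 then 1 else 0 :: real) ^ k) = (\<Sum>v\<in>?V. if v = v0 then 1 else 0)"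
      using k by (intro sum.cong) (auto simp: power_0_left)
    then show ?thesis using v0 fin by (auto simp: P_def S_def)
  qed
  then have neK: "P \<inter> {x. ?g x = 1} \<noteq> {}" by blast
  have "continuous_on UNIV ?f"
    unfolding edge_weight_def by (intro continuous_intros coord)
  then have "continuous_on (P \<inter> {x. ?g x = 1}) ?f"
    using continuous_on_subset by blast
  from continuous_attains_sup[OF cK neK this] obtain x
    where x: "x \<in> P" "?g x = 1" and max: "\<And>y. y \<in> P \<Longrightarrow> ?g y = 1 \<Longrightarrow> ?f y \<le> ?f x"
    by auto
  have x0: "\<forall>v\<in>?V. 0 \<le> x v"
  proof
    fix v assume "v \<in> ?V"
    moreover have "x v \<in> S v" using x(1) by (auto simp: P_def)
    ultimately show "0 \<le> x v" by (simp add: S_def)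
  qed
  have "spectral_radius k H = ?f x"
    unfolding spectral_radius_def
  proof (rule Greatest_equality)
    show "\<exists>xa. (\<forall>v\<in>?V. 0 \<le> xa v) \<and> ?g xa = 1 \<and> ?f x = real k * (\<Sum>F\<in>edges H. \<Prod>v\<in>F. xa v)"
      using x0 x(2) by (auto simp: edge_weight_def)
  next
    fix r assume "\<exists>x. (\<forall>v\<in>?V. 0 \<le> x v) \<and> ?g x = 1 \<and> r = real k * (\<Sum>F\<in>edges H. \<Prod>v\<in>F. x v)"
    then obtain y where y: "\<forall>v\<in>?V. 0 \<le> y v" "?g y = 1" "r = real k * (\<Sum>F\<in>edges H. \<Prod>v\<in>F. y v)"
      by blast
    define z where "z v = (if v \<in> ?V then y v else 0)" for v
    have "?g z = 1" using y(2) by (simp add: z_def)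
    moreover have "z \<in> P"
    proof -
      have "y v \<le> 1" if "v \<in> ?V" for v
        using entry_le_1[of ?V v y k] fin that y k by blast
      then show ?thesis using y(1) by (auto simp: P_def S_def z_def)
    qed
    ultimately have "?f z \<le> ?f x" using max by blast
    moreover have "?f z = r"
    proof -
      have "(\<Prod>v\<in>F. z v) = (\<Prod>v\<in>F. y v)" if "F \<in> edges H" for F
        using sub[OF that] by (intro prod.cong) (auto simp: z_def)
      then show ?thesis by (simp add: edge_weight_def y(3))
    qed
    ultimately show "r \<le> ?f x" by simp
  qed
  then show thesis using that x0 x(2) by blast
qed

text \<open>The weight is linear in the entries on \<open>N\<close>, with the common rate
  \<open>esym (k - 1) x A\<close>. This is the rate against which all other vertices are
  measured.\<close>

lemma edge_weight_split_edges:
  assumes fin: "finite A" "finite N" and disj: "A \<inter> N = {}" and k: "k > 0"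
  shows "edge_weight x (split_edges k A N) = esym k x A + esym (k - 1) x A * (\<Sum>v\<in>N. x v)"
proof -
  let ?i = "\<lambda>(v, T). insert v T"
  let ?J = "N \<times> nsets A (k - 1)"
  have inj: "inj_on ?i ?J"
  proof (rule inj_onI, clarify)
    fix v T v' T' assume *: "v \<in> N" "v' \<in> N" "T \<in> nsets A (k - 1)" "T' \<in> nsets A (k - 1)"
      "insert v T = insert v' T'"
    then have "v \<notin> T" "v \<notin> T'" "v' \<notin> T" "v' \<notin> T'" using disj by (auto simp: nsets_def)
    moreover from this *(5) have "v = v'" by (metis insertE insertI1)
    ultimately show "v = v' \<and> T = T'" using *(5) by (metis insert_ident)
  qed
  have eq: "split_edges k A N = nsets A k \<union> ?i ` ?J"
  proof (intro equalityI subsetI)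
    fix F assume "F \<in> split_edges k A N"
    then have F: "F \<subseteq> A \<union> N" "finite F" "card F = k" "\<And>u v. u \<in> F \<inter> N \<Longrightarrow> v \<in> F \<inter> N \<Longrightarrow> u = v"
      by (auto simp: split_edges_def nsets_def)
    show "F \<in> nsets A k \<union> ?i ` ?J"
    proof (cases "F \<inter> N = {}")
      case True
      then show ?thesis using F by (auto simp: nsets_def)
    next
      case False
      then obtain v where v: "v \<in> F" "v \<in> N" by blast
      then have "F - {v} \<subseteq> A" using F by blast
      then have "F - {v} \<in> nsets A (k - 1)" using F v by (simp add: nsets_def)
      moreover have "F = ?i (v, F - {v})" using v by auto
      ultimately show ?thesis using v by (intro UnI2 image_eqI[of _ _ "(v, F - {v})"]) auto
    qed
  next
    fix F assume "F \<in> nsets A k \<union> ?i ` ?J"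
    then show "F \<in> split_edges k A N"
    proof
      assume "F \<in> nsets A k"
      then show ?thesis using disj by (auto simp: split_edges_def nsets_def)
    next
      assume "F \<in> ?i ` ?J"
      then obtain v T where "v \<in> N" "T \<in> nsets A (k - 1)" "F = insert v T" by auto
      moreover from this have "v \<notin> T" using disj by (auto simp: nsets_def)
      ultimately show ?thesis using disj k by (auto simp: split_edges_def nsets_def)
    qed
  qed
  have "nsets A k \<inter> ?i ` ?J = {}" using disj by (auto simp: nsets_def)
  then have "edge_weight x (split_edges k A N) = esym k x A + (\<Sum>F\<in>?i ` ?J. \<Prod>v\<in>F. x v)"
    unfolding edge_weight_def eq using fin by (subst sum.union_disjoint) (auto simp: esym_def)
  also have "(\<Sum>F\<in>?i ` ?J. \<Prod>v\<in>F. x v) = (\<Sum>(v,T)\<in>?J. x v * (\<Prod>u\<in>T. x u))"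
  proof (subst sum.reindex[OF inj], rule sum.cong[OF refl], clarify)
    fix v T assume "v \<in> N" "T \<in> nsets A (k - 1)"
    moreover from this have "v \<notin> T" using disj by (auto simp: nsets_def)
    ultimately show "((\<lambda>F. \<Prod>v\<in>F. x v) \<circ> ?i) (v, T) = x v * (\<Prod>u\<in>T. x u)"
      by (simp add: nsets_def)
  qed
  also have "\<dots> = (\<Sum>v\<in>N. \<Sum>T\<in>nsets A (k - 1). x v * (\<Prod>u\<in>T. x u))"
    by (rule sum.cartesian_product[symmetric])
  also have "\<dots> = (\<Sum>v\<in>N. x v) * esym (k - 1) x A"
    by (simp add: esym_def sum_product)
  finally show ?thesis by (simp add: mult.commute)
qed

text \<open>\<open>\<theta>\<close> is the ratio of the two entries of the principal eigenvector, and the two equations are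
  the eigenvalue equations.\<close>

lemma B_equation_ratio:
  assumes "k \<ge> 2" "a \<ge> k - 1" "n > a" and gt: "real ((a - 1) choose (k - 1)) < r"
    and eq: "B_equation k a n r"
  obtains \<theta> where "\<theta> > 0"
    "(real n - real a) * real ((a - 1) choose (k - 2)) = (r - real ((a - 1) choose (k - 1))) * \<theta>"
    "real (a choose (k - 1)) * \<theta> ^ (k - 1) = r"
proof -
  let ?p = "real ((a - 1) choose (k - 2))" and ?q = "real ((a - 1) choose (k - 1))"
  let ?m = "real n - real a"
  \<comment> \<open>The eigenvalue equation at a vertex of the clique side, solved for \<theta>.
    Inserting it into the one at a vertex of the independent side gives
    \<open>B_equation\<close>.\<close>
  define \<theta> where "\<theta> = ?m * ?p / (r - ?q)"
  have p: "?p > 0" using assms by (simp add: zero_less_binomial_iff)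
  have "\<theta> > 0" using p assms by (simp add: \<theta>_def)
  moreover have "?m * ?p = (r - ?q) * \<theta>" using gt by (simp add: \<theta>_def)
  moreover have "real (a choose (k - 1)) * \<theta> ^ (k - 1) = r"
  proof -
    have "real (a choose (k - 1)) * (?m * ?p) ^ (k - 1) = r * (r - ?q) ^ (k - 1)"
      using eq by (simp add: B_equation_def power_mult_distrib mult_ac)
    then show ?thesis using gt by (simp add: \<theta>_def power_divide)
  qed
  ultimately show thesis using that by blast
qed

text \<open>Sum \<open>esym_mult_le\<close> over \<open>N\<close> with \<theta> the eigenvector
  ratio and add \<open>esym_self_le\<close> for the edges inside \<open>A\<close>. The two
  eigenvalue equations turn the coefficients of both parts of the norm into \<open>r\<close>. The
  strict version later shows that an extremal vector vanishes nowhere on \<open>N\<close>.\<close>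

lemma split_edges_weight_le:
  assumes fin: "finite A" "finite N" and disj: "A \<inter> N = {}" and k: "k \<ge> 2" "card A \<ge> k - 1"
    and "N \<noteq> {}" and x: "\<And>v. v \<in> A \<union> N \<Longrightarrow> 0 \<le> x v"
    and gt: "real ((card A - 1) choose (k - 1)) < r"
    and eq: "B_equation k (card A) (card A + card N) r"
  shows "real k * edge_weight x (split_edges k A N) \<le> r * (\<Sum>v\<in>A \<union> N. x v ^ k)"
    and "u \<in> N \<Longrightarrow> x u = 0 \<Longrightarrow> 0 < (\<Sum>v\<in>A. x v ^ k) \<Longrightarrow>
      real k * edge_weight x (split_edges k A N) < r * (\<Sum>v\<in>A \<union> N. x v ^ k)"
proof -
  let ?p = "real ((card A - 1) choose (k - 2))" and ?q = "real ((card A - 1) choose (k - 1))"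
  let ?C = "real (card A choose (k - 1))" and ?m = "real (card N)"
  let ?W = "\<Sum>v\<in>A. x v ^ k" and ?Y = "\<Sum>v\<in>N. x v ^ k" and ?X = "\<Sum>v\<in>N. x v"
  let ?e = "esym (k - 1) x A"
  have "card N > 0" using \<open>N \<noteq> {}\<close> fin by (simp add: card_gt_0_iff)
  then obtain \<theta> where \<theta>: "\<theta> > 0" "?m * ?p = (r - ?q) * \<theta>" "?C * \<theta> ^ (k - 1) = r"
    using B_equation_ratio[OF k, of "card A + card N" r] gt eq by auto
  have p: "?p > 0" using k by (simp add: zero_less_binomial_iff)
  have W: "?W \<ge> 0" using x by (intro sum_nonneg) auto
  have kk: "\<theta> ^ k = \<theta> ^ (k - 1) * \<theta>" using k by (metis power_minus_mult zero_less_numeral less_le_trans)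
  have each: "real k * \<theta> * ?e * x v \<le> ?p * ?W + ?C * \<theta> ^ k * x v ^ k" if "v \<in> N" for v
    using esym_mult_le[of A k x "x v" \<theta>] fin k x \<theta> that by auto
  have lhs: "(\<Sum>v\<in>N. real k * \<theta> * ?e * x v) = \<theta> * (real k * ?e * ?X)"
  proof -
    have "(\<Sum>v\<in>N. real k * \<theta> * ?e * x v) = real k * \<theta> * ?e * ?X"
      by (simp only: sum_distrib_left)
    then show ?thesis by (simp add: mult_ac)
  qed
  have rhs: "(\<Sum>v\<in>N. ?p * ?W + ?C * \<theta> ^ k * x v ^ k) = \<theta> * ((r - ?q) * ?W + r * ?Y)"
  proof -
    have "(\<Sum>v\<in>N. ?p * ?W + ?C * \<theta> ^ k * x v ^ k) = ?m * (?p * ?W) + ?C * \<theta> ^ k * ?Y"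
      by (simp only: sum.distrib sum_constant sum_distrib_left)
    also have "\<dots> = (?m * ?p) * ?W + (?C * \<theta> ^ (k - 1)) * \<theta> * ?Y"
      by (simp only: kk mult.assoc)
    also have "\<dots> = \<theta> * ((r - ?q) * ?W + r * ?Y)"
      unfolding \<theta>(2,3) by (simp add: algebra_simps)
    finally show ?thesis .
  qed
  have self: "real k * esym k x A \<le> ?q * ?W"
    using esym_self_le[of A k x] fin k x by auto
  have tot: "(\<Sum>v\<in>A \<union> N. x v ^ k) = ?W + ?Y"
    using fin disj by (simp add: sum.union_disjoint)
  have val: "real k * edge_weight x (split_edges k A N) = real k * esym k x A + real k * ?e * ?X"
    using edge_weight_split_edges[OF fin disj, of k x] k by (simp add: algebra_simps)
  have "\<theta> * (real k * ?e * ?X) \<le> \<theta> * ((r - ?q) * ?W + r * ?Y)"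
    unfolding lhs[symmetric] rhs[symmetric] by (rule sum_mono) (rule each)
  then have "real k * ?e * ?X \<le> (r - ?q) * ?W + r * ?Y" using \<theta>(1) by simp
  then show "real k * edge_weight x (split_edges k A N) \<le> r * (\<Sum>v\<in>A \<union> N. x v ^ k)"
    unfolding val tot using self by (simp add: algebra_simps)
  assume u: "u \<in> N" "x u = 0" "0 < ?W"
  \<comment> \<open>At a zero entry the AM-GM bound reads 0 < \<open>?p * ?W\<close>, so one summand
    is strict.\<close>
  have u': "real k * \<theta> * ?e * x u < ?p * ?W + ?C * \<theta> ^ k * x u ^ k"
    using u p k by (simp add: power_0_left)
  then have "\<theta> * (real k * ?e * ?X) < \<theta> * ((r - ?q) * ?W + r * ?Y)"
    unfolding lhs[symmetric] rhs[symmetric] using fin each u(1) u'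
    by (intro sum_strict_mono_ex1 ballI bexI[of _ u])
  then have "real k * ?e * ?X < (r - ?q) * ?W + r * ?Y" using \<theta>(1) by simp
  then show "real k * edge_weight x (split_edges k A N) < r * (\<Sum>v\<in>A \<union> N. x v ^ k)"
    unfolding val tot using self by (simp add: algebra_simps)
qed

lemma esym_const:
  assumes "finite S" "\<And>v. v \<in> S \<Longrightarrow> x v = s"
  shows "esym j x S = real (card S choose j) * s ^ j"
proof -
  have "esym j x S = (\<Sum>T\<in>nsets S j. s ^ j)"
    unfolding esym_def
  proof (rule sum.cong[OF refl])
    fix T assume "T \<in> nsets S j"
    then have "T \<subseteq> S" "card T = j" by (auto simp: nsets_def)
    then have "(\<Prod>v\<in>T. x v) = (\<Prod>v\<in>T. s)" using assms(2) by (intro prod.cong) auto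
    with \<open>card T = j\<close> show "(\<Prod>v\<in>T. x v) = s ^ j" by simp
  qed
  then show ?thesis using assms(1) by (simp add: card_nsets)
qed

text \<open>The equality case of the AM-GM bounds: entries \<open>\<theta> * w\<close> on
  \<open>A\<close> and \<open>w\<close> on \<open>N\<close>, with \<open>w\<close> fixed by the
  norm.\<close>

lemma split_edges_weight_attained:
  assumes fin: "finite A" "finite N" and disj: "A \<inter> N = {}" and k: "k \<ge> 2" "card A \<ge> k - 1"
    and "N \<noteq> {}" and gt: "real ((card A - 1) choose (k - 1)) < r"
    and eq: "B_equation k (card A) (card A + card N) r"
  obtains x where "\<forall>v. 0 \<le> x v" "(\<Sum>v\<in>A \<union> N. x v ^ k) = 1"
    "real k * edge_weight x (split_edges k A N) = r"
proof -
  let ?a = "real (card A)"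
  let ?p = "real ((card A - 1) choose (k - 2))" and ?q = "real ((card A - 1) choose (k - 1))"
  let ?C = "real (card A choose (k - 1))" and ?m = "real (card N)"
  have m: "card N > 0" using \<open>N \<noteq> {}\<close> fin by (simp add: card_gt_0_iff)
  then obtain \<theta> where \<theta>: "\<theta> > 0" "?m * ?p = (r - ?q) * \<theta>" "?C * \<theta> ^ (k - 1) = r"
    using B_equation_ratio[OF k, of "card A + card N" r] gt eq by auto
  have kk: "z ^ k = z ^ (k - 1) * z" for z :: real
    using k by (metis power_minus_mult zero_less_numeral less_le_trans)
  define w where "w = root k (1 / (?a * \<theta> ^ k + ?m))"
  have pos: "?a * \<theta> ^ k + ?m > 0" using m \<theta>(1) by (simp add: add_nonneg_pos)
  have w0: "w \<ge> 0" unfolding w_def by (intro real_root_ge_zero) (use pos in simp)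
  have wk: "w ^ k * (?a * \<theta> ^ k + ?m) = 1"
    using pos k by (simp add: w_def)
  define x where "x v = (if v \<in> A then \<theta> * w else w)" for v
  have A: "x v = \<theta> * w" if "v \<in> A" for v using that by (simp add: x_def)
  have N: "x v = w" if "v \<in> N" for v using that disj by (auto simp: x_def)
  have "(\<Sum>v\<in>A \<union> N. x v ^ k) = ?a * (\<theta> * w) ^ k + ?m * w ^ k"
    using fin disj A N by (simp add: sum.union_disjoint)
  also have "\<dots> = 1" using wk by (simp add: power_mult_distrib algebra_simps)
  finally have 1: "(\<Sum>v\<in>A \<union> N. x v ^ k) = 1" .
  \<comment> \<open>\<open>ab\<close> and \<open>bc\<close> count incidences: an edge inside
    \<open>A\<close> has \<open>k\<close> vertices there, and among the edges through a fixed vertex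
    of \<open>N\<close> each has that vertex and k - 1 vertices of \<open>A\<close>.\<close>
  have ab: "real k * real (card A choose k) = ?a * ?q"
    using times_binomial_minus1_eq[of k "card A"] k by (metis of_nat_mult less_le_trans zero_less_numeral)
  have "(k - 1) * (card A choose (k - 1)) = card A * ((card A - 1) choose (k - 1 - 1))"
    using k by (intro times_binomial_minus1_eq) simp
  then have "real ((k - 1) * (card A choose (k - 1))) = real (card A * ((card A - 1) choose (k - 1 - 1)))"
    by (rule arg_cong)
  then have bc: "real k * ?C = ?C + ?a * ?p"
    using k by (simp add: diff_diff_eq numeral_2_eq_2 of_nat_diff algebra_simps)
  have "real k * edge_weight x (split_edges k A N)
      = real k * real (card A choose k) * (\<theta> * w) ^ k + real k * ?C * (\<theta> * w) ^ (k - 1) * (?m * w)"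
    using edge_weight_split_edges[OF fin disj, of k x] k esym_const[OF fin(1), of x "\<theta> * w"] A N
    by (simp add: algebra_simps)
  also have "\<dots> = w ^ k * (?a * ?q * \<theta> ^ k + (?C + ?a * ?p) * \<theta> ^ (k - 1) * ?m)"
    unfolding ab bc by (simp add: kk[of w] power_mult_distrib algebra_simps)
  also have "(?C + ?a * ?p) * \<theta> ^ (k - 1) * ?m
      = (?C * \<theta> ^ (k - 1)) * ?m + ?a * \<theta> ^ (k - 1) * (?m * ?p)"
    by (simp add: algebra_simps)
  also have "\<dots> = r * ?m + ?a * (r - ?q) * \<theta> ^ k"
    unfolding \<theta>(2,3) kk[of \<theta>] by (simp add: algebra_simps)
  also have "w ^ k * (?a * ?q * \<theta> ^ k + (r * ?m + ?a * (r - ?q) * \<theta> ^ k))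
      = r * (w ^ k * (?a * \<theta> ^ k + ?m))"
    by (simp add: algebra_simps)
  also have "\<dots> = r" using wk by simp
  finally have 2: "real k * edge_weight x (split_edges k A N) = r" .
  have "\<forall>v. 0 \<le> x v" using w0 \<theta>(1) by (simp add: x_def)
  with 1 2 show thesis using that by blast
qed

lemma spectral_radius_B_hypergraph:
  assumes "k \<ge> 2" "t \<ge> k + 1" "n > t - 2"
    and gt: "real ((t - 2 - 1) choose (k - 1)) < r" and eq: "B_equation k (t - 2) n r"
  shows "spectral_radius k (B_hypergraph k n t) = r"
proof -
  let ?H = "B_hypergraph k n t"
  let ?A = "Inl ` {..<t - 2} :: (nat + nat) set" and ?N = "Inr ` {..<n - (t - 2)} :: (nat + nat) set"
  have cA: "card ?A = t - 2" and cN: "card ?N = n - (t - 2)" by (simp_all add: card_image)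
  have "k - 1 \<le> t - 2" using assms(2) by simp
  moreover have "card ?N \<noteq> 0" unfolding cN using assms(3) by simp
  then have "?N \<noteq> {}" by (metis card.empty)
  ultimately have *: "finite ?A" "finite ?N" "?A \<inter> ?N = {}" "k - 1 \<le> card ?A" "?N \<noteq> {}"
    unfolding cA by auto
  have gt': "real ((card ?A - 1) choose (k - 1)) < r"
    and eq': "B_equation k (card ?A) (card ?A + card ?N) r"
    using gt eq \<open>t - 2 < n\<close> unfolding cA cN by (simp_all only: le_add_diff_inverse less_imp_le)
  note V = vertices_B_hypergraph[of k n t] and E = edges_B_hypergraph[of k n t]
  show ?thesis
    unfolding spectral_radius_def
  proof (rule Greatest_equality)
    obtain x where "\<forall>v. 0 \<le> x v" "(\<Sum>v\<in>?A \<union> ?N. x v ^ k) = 1"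
      "real k * edge_weight x (split_edges k ?A ?N) = r"
      using split_edges_weight_attained[OF *(1-3) assms(1) *(4,5) gt' eq'] .
    then show "\<exists>x. (\<forall>v\<in>vertices ?H. 0 \<le> x v) \<and> (\<Sum>v\<in>vertices ?H. x v ^ k) = 1 \<and>
        r = real k * (\<Sum>F\<in>edges ?H. \<Prod>v\<in>F. x v)"
      unfolding V E edge_weight_def by (intro exI[of _ x]) simp
  next
    fix s assume "\<exists>x. (\<forall>v\<in>vertices ?H. 0 \<le> x v) \<and> (\<Sum>v\<in>vertices ?H. x v ^ k) = 1 \<and>
        s = real k * (\<Sum>F\<in>edges ?H. \<Prod>v\<in>F. x v)"
    then obtain x where x: "\<forall>v\<in>?A \<union> ?N. 0 \<le> x v" "(\<Sum>v\<in>?A \<union> ?N. x v ^ k) = 1"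
        "s = real k * edge_weight x (split_edges k ?A ?N)"
      unfolding V E edge_weight_def by blast
    show "s \<le> r"
      using split_edges_weight_le(1)[OF *(1-3) assms(1) *(4,5) _ gt' eq', of x] x by simp
  qed
qed

section \<open>The root of the equation and its growth\<close>

lemma B_equation_unique_root:
  assumes "k \<ge> 2" "n > a" "a \<ge> k - 1"
  shows "\<exists>!r. real ((a - 1) choose (k - 1)) < r \<and> B_equation k a n r"
proof -
  define q where "q = real ((a - 1) choose (k - 1))"
  define K where "K = real ((a - 1) choose (k - 2)) ^ (k - 1) * real (a choose (k - 1)) * (real n - real a) ^ (k - 1)"
  have q: "q \<ge> 0" by (simp add: q_def)
  have K: "K > 0" using assms by (simp add: K_def zero_less_binomial_iff)
  let ?f = "\<lambda>r. r * (r - q) ^ (k - 1)"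
  \<comment> \<open>At \<open>q + K + 1\<close> the factor \<open>r\<close> is at least
    \<open>K + 1\<close> and the power is at least 1, so the left side exceeds
    \<open>K\<close>.\<close>
  have "\<exists>r. q \<le> r \<and> r \<le> q + K + 1 \<and> ?f r = K"
  proof (rule IVT')
    show "?f q \<le> K" using K assms by (simp add: power_0_left)
    have "K \<le> 1 * (K + 1)" using K by simp
    also have "\<dots> \<le> (K + 1) ^ (k - 1) * (q + K + 1)"
      using K q by (intro mult_mono one_le_power) auto
    finally show "K \<le> ?f (q + K + 1)" by (simp add: mult.commute)
    show "q \<le> q + K + 1" using K by simp
    show "continuous_on {q..q + K + 1} ?f" by (intro continuous_intros)
  qed
  then obtain r where r: "q \<le> r" "?f r = K" by blast
  have "r \<noteq> q" using r(2) K assms by (auto simp: power_0_left)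
  then have "q < r" using r(1) by simp
  moreover have "r = s" if "q < r" "?f r = K" "q < s" "?f s = K" for r s
  proof -
    have mono: "?f u < ?f v" if "q < u" "u < v" for u v
      using that q assms by (intro mult_strict_mono power_strict_mono) auto
    show ?thesis
    proof (rule ccontr)
      assume "r \<noteq> s"
      then consider "r < s" | "s < r" by linarith
      then show False
        by cases (use mono[of r s] mono[of s r] that in auto)
    qed
  qed
  ultimately show ?thesis
    using r(2) unfolding B_equation_def q_def[symmetric] K_def[symmetric] by blast
qed

lemma powr_ratio_power:
  fixes z :: real
  assumes "z \<ge> 0" "k \<ge> 2"
  shows "(z powr ((real k - 1) / real k)) ^ k = z ^ (k - 1)"
proof (cases "z = 0")
  case False
  then have "(z powr ((real k - 1) / real k)) ^ k = z powr ((real k - 1) / real k * real k)"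
    using assms by (simp add: powr_powr flip: powr_realpow)
  also have "\<dots> = z powr real (k - 1)" using assms by (simp add: of_nat_diff)
  also have "\<dots> = z ^ (k - 1)" using False assms by (intro powr_realpow) simp
  finally show ?thesis .
qed (use assms in \<open>auto simp: power_0_left\<close>)

lemma B_constant_power:
  assumes "k \<ge> 2" "t \<ge> 2"
  shows "B_constant k t ^ k = real ((t - 3) choose (k - 2)) ^ (k - 1) * real ((t - 2) choose (k - 1))"
proof -
  have "(real ((t - 2) choose (k - 1)) powr (1 / real k)) ^ k = real ((t - 2) choose (k - 1))"
    using assms by (simp flip: root_powr_inverse)
  then show ?thesis
    using assms powr_ratio_power[of "real ((t - 3) choose (k - 2))" k]
    by (simp add: B_constant_def power_mult_distrib)
qed

text \<open>The equation says that \<open>M ^ k\<close> is \<open>r * (r - q) ^ (k - 1)\<close> with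
  q the lower end of the interval, and this lies between \<open>(r - q) ^ k\<close> and
  \<open>r ^ k\<close>. So \<open>r\<close> equals \<open>M\<close> up to a constant, which
  disappears on division by the growth rate.\<close>

lemma B_equation_bounds:
  assumes k: "k \<ge> 2" and t: "t \<ge> k + 1" and n: "n > t - 2"
    and gt: "real ((t - 2 - 1) choose (k - 1)) < r" and eq: "B_equation k (t - 2) n r"
  defines "M \<equiv> B_constant k t * (real n - real (t - 2)) powr ((real k - 1) / real k)"
  shows "M \<le> r" "r \<le> real ((t - 2 - 1) choose (k - 1)) + M"
proof -
  let ?q = "real ((t - 2 - 1) choose (k - 1))"
  have "B_constant k t \<ge> 0" by (simp add: B_constant_def)
  then have M0: "M \<ge> 0" by (simp add: M_def)
  have t3: "t - 2 - 1 = t - 3" by simp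
  define z where "z = real n - real (t - 2)"
  have "z > 0" using n by (simp only: z_def diff_gt_0_iff_gt of_nat_less_iff)
  then have "(z powr ((real k - 1) / real k)) ^ k = z ^ (k - 1)"
    using powr_ratio_power[of z k] k by simp
  moreover have "r * (r - ?q) ^ (k - 1) = B_constant k t ^ k * z ^ (k - 1)"
    using eq B_constant_power[of k t] k t by (simp add: B_equation_def z_def t3)
  ultimately have Mk: "M ^ k = r * (r - ?q) ^ (k - 1)"
    by (simp add: M_def z_def power_mult_distrib)
  have kk: "z ^ k = z * z ^ (k - 1)" for z :: real
    using k by (metis mult.commute power_minus_mult zero_less_numeral less_le_trans)
  have k0: "k > 0" using k by simp
  have "M ^ k \<le> r ^ k"
    unfolding Mk kk[of r] using gt by (intro mult_left_mono power_mono) auto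
  then show "M \<le> r" using M0 k0 gt by (metis power_mono_iff le_less_trans less_imp_le of_nat_0_le_iff)
  have "(r - ?q) ^ k \<le> M ^ k"
    unfolding Mk kk[of "r - ?q"] using gt by (intro mult_right_mono) auto
  then have "r - ?q \<le> M" using M0 k0 gt by (simp add: power_mono_iff)
  then show "r \<le> ?q + M" by simp
qed

lemma spectral_radius_B_hypergraph_asymp:
  assumes k: "k \<ge> 2" and t: "t \<ge> k + 1"
  shows "(\<lambda>n. spectral_radius k (B_hypergraph k n t) / real n powr ((real k - 1) / real k))
    \<longlonglongrightarrow> B_constant k t"
proof -
  let ?\<beta> = "(real k - 1) / real k"
  let ?q = "real ((t - 2 - 1) choose (k - 1))" and ?c = "B_constant k t"
  let ?\<rho> = "\<lambda>n. spectral_radius k (B_hypergraph k n t)"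
  let ?m = "\<lambda>n. real n - real (t - 2)"
  have bnd: "?c * ?m n powr ?\<beta> \<le> ?\<rho> n" "?\<rho> n \<le> ?q + ?c * ?m n powr ?\<beta>" if n: "n > t - 2" for n
  proof -
    have "\<exists>!r. ?q < r \<and> B_equation k (t - 2) n r"
      using k t n by (intro B_equation_unique_root) auto
    then obtain r where r: "?q < r" "B_equation k (t - 2) n r" by blast
    then have "?\<rho> n = r"
      using spectral_radius_B_hypergraph k t n by blast
    then show "?c * ?m n powr ?\<beta> \<le> ?\<rho> n" "?\<rho> n \<le> ?q + ?c * ?m n powr ?\<beta>"
      using B_equation_bounds[OF k t n r] by simp_all
  qed
  have \<beta>: "?\<beta> > 0" using k by simp
  have "(\<lambda>n. 1 - real (t - 2) / real n) \<longlonglongrightarrow> 1 - 0"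
    by (intro tendsto_intros lim_const_over_n)
  then have "(\<lambda>n. (1 - real (t - 2) / real n) powr ?\<beta>) \<longlonglongrightarrow> 1 powr ?\<beta>"
    by (intro tendsto_powr tendsto_const) auto
  then have l1: "(\<lambda>n. ?c * (1 - real (t - 2) / real n) powr ?\<beta>) \<longlonglongrightarrow> ?c"
    using tendsto_mult_left[of _ "1" sequentially ?c] by simp
  have "(\<lambda>n. real n powr (- ?\<beta>)) \<longlonglongrightarrow> 0"
    using \<beta> by (intro tendsto_neg_powr filterlim_real_sequentially) auto
  then have l2: "(\<lambda>n. ?q * real n powr (- ?\<beta>) + ?c * (1 - real (t - 2) / real n) powr ?\<beta>) \<longlonglongrightarrow> ?q * 0 + ?c"
    by (intro tendsto_add tendsto_mult l1 tendsto_const)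
  have eqm: "?m n powr ?\<beta> / real n powr ?\<beta> = (1 - real (t - 2) / real n) powr ?\<beta>" if "n > t - 2" for n
  proof -
    have "1 - real (t - 2) / real n = ?m n / real n" using that by (simp add: field_simps)
    then show ?thesis using that by (simp add: powr_divide)
  qed
  show ?thesis
  proof (rule tendsto_sandwich[OF _ _ l1])
    show "\<forall>\<^sub>F n in sequentially. ?c * (1 - real (t - 2) / real n) powr ?\<beta> \<le> ?\<rho> n / real n powr ?\<beta>"
      using eventually_gt_at_top[of "t - 2"]
    proof eventually_elim
      case (elim n)
      then show ?case
        using divide_right_mono[OF bnd(1)[OF elim], of "real n powr ?\<beta>"]
        unfolding eqm[OF elim, symmetric] by simp
    qed
    show "\<forall>\<^sub>F n in sequentially. ?\<rho> n / real n powr ?\<beta>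
        \<le> ?q * real n powr (- ?\<beta>) + ?c * (1 - real (t - 2) / real n) powr ?\<beta>"
      using eventually_gt_at_top[of "t - 2"]
    proof eventually_elim
      case (elim n)
      then show ?case
        using divide_right_mono[OF bnd(2)[OF elim], of "real n powr ?\<beta>"]
        unfolding eqm[OF elim, symmetric] by (simp add: add_divide_distrib powr_minus_divide)
    qed
    show "(\<lambda>n. ?q * real n powr (- ?\<beta>) + ?c * (1 - real (t - 2) / real n) powr ?\<beta>) \<longlonglongrightarrow> ?c"
      using l2 by simp
  qed
qed

section \<open>Edge sums in minor-free hypergraphs\<close>

lemma prod_le_factor:
  fixes x :: "'a \<Rightarrow> real"
  assumes "finite T" "w \<in> T" "\<And>v. v \<in> T \<Longrightarrow> 0 \<le> x v \<and> x v \<le> 1"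
  shows "(\<Prod>v\<in>T. x v) \<le> x w"
proof -
  have "(\<Prod>v\<in>T. x v) = x w * (\<Prod>v\<in>T - {w}. x v)"
    using assms by (simp add: prod.remove)
  also have "\<dots> \<le> x w * 1"
    using assms by (intro mult_left_mono prod_le_1) auto
  finally show ?thesis by simp
qed

lemma edge_weight_union_le:
  assumes "finite E" "finite E'" "\<And>F v. F \<in> E' \<Longrightarrow> v \<in> F \<Longrightarrow> 0 \<le> x v"
  shows "edge_weight x (E \<union> E') \<le> edge_weight x E + edge_weight x E'"
proof -
  have "edge_weight x (E \<union> E') = edge_weight x E + edge_weight x (E' - E)"
    unfolding edge_weight_def using assms
    by (subst sum.union_disjoint[symmetric]) auto
  also have "edge_weight x (E' - E) \<le> edge_weight x E'"
    unfolding edge_weight_def using assms by (intro sum_mono2 prod_nonneg) auto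
  finally show ?thesis by simp
qed

text \<open>A vertex is heavy if its entry is at least \<open>\<tau>\<close>. Edges with two light vertices are controlled by
  degeneracy. An edge with one light vertex \<open>v\<close> lies in the heavy neighbourhood of \<open>v\<close>; vertices
  whose heavy neighbourhood is shared by fewer than \<open>t\<close> light vertices contribute only \<open>O(1)\<close>.\<close>

lemma edge_weight_light_heavy:
  fixes x :: "'a \<Rightarrow> real" and G :: "'a graph"
  assumes V: "finite V" and E: "E \<subseteq> nsets V k" "\<And>F. F \<in> E \<Longrightarrow> clique F (edges G)"
    and loop: "\<And>v. {v} \<notin> edges G" and minor: "\<not> clique_minor_in G V t" and k: "k > 0"
    and x: "\<And>v. v \<in> V \<Longrightarrow> 0 \<le> x v" "(\<Sum>v\<in>V. x v ^ k) = 1"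
    and \<tau>: "\<tau> > 0" "1 / \<tau> ^ k \<le> real M" and c: "c \<ge> 0"
  defines "L \<equiv> {v \<in> V. \<tau> \<le> x v}" and "I \<equiv> {v \<in> V. x v < \<tau>}"
    and "Nb \<equiv> \<lambda>v. {u \<in> V. \<tau> \<le> x u \<and> {v, u} \<in> edges G}"
  assumes pop: "\<And>v. v \<in> I \<Longrightarrow> t \<le> card {w \<in> I. Nb w = Nb v} \<Longrightarrow>
      esym (k - 1) x (Nb v) * (\<Sum>w\<in>I. x w) \<le> c"
  shows "edge_weight x E \<le> 2 ^ M + 2 ^ M * real t * 2 ^ M + c + 2 ^ 2 ^ (t + 1) * \<tau> * (\<Sum>v\<in>V. x v)"
proof -
  have finL: "finite L" and finI: "finite I" and finE: "finite E"
    using V finite_subset[OF E(1)] by (auto simp: L_def I_def)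
  have VLI: "V = L \<union> I" "L \<inter> I = {}" by (auto simp: L_def I_def)
  have NbL: "Nb v \<subseteq> L" for v by (auto simp: Nb_def L_def)
  have x1: "x v \<le> 1" if "v \<in> V" for v
    using entry_le_1[of V v x k] V that x k by blast
  \<comment> \<open>Each heavy vertex uses at least \<open>\<tau> ^ k\<close> of the unit norm, so
    their number is bounded independently of the order of the graph.\<close>
  have cardL: "card L \<le> M"
  proof -
    have "real (card L) * \<tau> ^ k = (\<Sum>v\<in>L. \<tau> ^ k)" by simp
    also have "\<dots> \<le> (\<Sum>v\<in>L. x v ^ k)"
      using \<tau> by (intro sum_mono power_mono) (auto simp: L_def)
    also have "\<dots> \<le> (\<Sum>v\<in>V. x v ^ k)"
      using V x by (intro sum_mono2) (auto simp: L_def)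
    finally have "real (card L) \<le> 1 / \<tau> ^ k" using x(2) \<tau> by (simp add: field_simps)
    then show ?thesis using \<tau>(2) by linarith
  qed
  then have pow: "(2::real) ^ card L \<le> 2 ^ M" by (intro power_increasing) auto
  have esymL: "esym j x S \<le> 2 ^ M" if "S \<subseteq> L" for j S
  proof -
    have "esym j x S \<le> esym j x L"
      using finL that x by (intro esym_mono) (auto simp: L_def)
    also have "\<dots> \<le> 2 ^ card L" using finL x x1 by (intro esym_le_pow2) (auto simp: L_def)
    finally show ?thesis using pow by linarith
  qed
  have Fsub: "F \<subseteq> V" "finite F" "card F = k" if "F \<in> E" for F
    using E(1) that by (auto simp: nsets_def)
  obtain B where "\<forall>v\<in>V. B v \<subseteq> V \<and> card (B v) \<le> 2 ^ (t + 1)"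
    "\<forall>F\<subseteq>V. F \<noteq> {} \<and> clique F (edges G) \<longrightarrow> (\<exists>v\<in>F. F - {v} \<subseteq> B v)"
    using clique_minor_free_cover[OF V minor loop] by (elim exE conjE) (rule that)
  then have B: "\<And>v. v \<in> V \<Longrightarrow> B v \<subseteq> V \<and> card (B v) \<le> 2 ^ (t + 1)"
    "\<And>F. F \<subseteq> V \<Longrightarrow> F \<noteq> {} \<Longrightarrow> clique F (edges G) \<Longrightarrow> \<exists>v\<in>F. F - {v} \<subseteq> B v"
    by simp_all
  \<comment> \<open>\<open>E2\<close> contains every edge with two light vertices: one of them
    survives the deletion of the vertex to which the edge is charged. The classes may overlap, which
    is harmless for an upper bound.\<close>
  define E0 where "E0 = {F \<in> E. F \<subseteq> L}"
  define E1 where "E1 = {F \<in> E. \<exists>v\<in>F \<inter> I. F - {v} \<subseteq> L}"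
  define E2 where "E2 = {F \<in> E. \<exists>v\<in>F. F - {v} \<subseteq> B v \<and> (F - {v}) \<inter> I \<noteq> {}}"
  have "E \<subseteq> E0 \<union> (E1 \<union> E2)"
  proof
    fix F assume F: "F \<in> E"
    have "F \<noteq> {}" using Fsub[OF F] k by auto
    then obtain v where v: "v \<in> F" "F - {v} \<subseteq> B v" using B(2) Fsub[OF F] E(2)[OF F] by blast
    show "F \<in> E0 \<union> (E1 \<union> E2)"
    proof (cases "(F - {v}) \<inter> I = {}")
      case True
      then have "F - {v} \<subseteq> L" using Fsub[OF F] VLI by blast
      then show ?thesis using F v(1) VLI Fsub[OF F] by (cases "v \<in> I") (auto simp: E0_def E1_def)
    qed (use F v in \<open>auto simp: E2_def\<close>)
  qed
  then have "E = E0 \<union> (E1 \<union> E2)" by (auto simp: E0_def E1_def E2_def)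
  then have "edge_weight x E = edge_weight x (E0 \<union> (E1 \<union> E2))" by simp
  also have "\<dots> \<le> edge_weight x E0 + (edge_weight x E1 + edge_weight x E2)"
  proof -
    have fin: "finite E0" "finite E1" "finite E2"
      using finE by (auto simp: E0_def E1_def E2_def)
    have nonneg: "0 \<le> x v" if "F \<in> E1 \<union> E2" "v \<in> F" for F v
      using that Fsub(1)[of F] x(1) by (auto simp: E1_def E2_def)
    have "edge_weight x (E0 \<union> (E1 \<union> E2)) \<le> edge_weight x E0 + edge_weight x (E1 \<union> E2)"
      using fin nonneg by (intro edge_weight_union_le) auto
    moreover have "edge_weight x (E1 \<union> E2) \<le> edge_weight x E1 + edge_weight x E2"
      using fin nonneg by (intro edge_weight_union_le) auto
    ultimately show ?thesis by simp
  qed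
  finally have split: "edge_weight x E \<le> edge_weight x E0 + (edge_weight x E1 + edge_weight x E2)" .
  have b0: "edge_weight x E0 \<le> 2 ^ M"
  proof -
    have "edge_weight x E0 \<le> esym k x L"
      unfolding edge_weight_def esym_def using finL Fsub x(1)
      by (intro sum_mono2 prod_nonneg) (auto simp: E0_def nsets_def L_def)
    then show ?thesis using esymL[of L k] by simp
  qed
  have b2: "edge_weight x E2 \<le> 2 ^ 2 ^ (t + 1) * \<tau> * (\<Sum>v\<in>V. x v)"
  proof -
    \<comment> \<open>\<open>B v\<close> has at most 2^(t+1) elements, hence at most 2^2^(t+1)
      subsets, and each subset counted here contains a light vertex and so has product at most
      \<tau>.\<close>
    define \<T> where "\<T> v = {T \<in> Pow (B v). T \<inter> I \<noteq> {}}" for v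
    have finB: "finite (B v)" if "v \<in> V" for v using B(1)[OF that] V finite_subset by blast
    have "edge_weight x E2 \<le> (\<Sum>v\<in>V. x v * (\<Sum>T\<in>\<T> v. \<Prod>u\<in>T. x u))"
      unfolding edge_weight_def
    proof (rule sum_prod_cover_le)
      show "finite (\<T> v)" if "v \<in> V" for v using finB[OF that] by (simp add: \<T>_def)
      show "finite F" if "F \<in> E2" for F using that Fsub by (auto simp: E2_def)
      show "\<exists>v\<in>F \<inter> V. F - {v} \<in> \<T> v" if "F \<in> E2" for F
      proof -
        obtain v where "v \<in> F" "F - {v} \<subseteq> B v" "(F - {v}) \<inter> I \<noteq> {}" "F \<in> E"
          using \<open>F \<in> E2\<close> by (auto simp: E2_def)
        then show ?thesis using Fsub[of F] by (intro bexI[of _ v]) (auto simp: \<T>_def)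
      qed
      show "0 \<le> x u" if "v \<in> V" "T \<in> \<T> v" "u \<in> T" for v T u
        using that B(1)[of v] x(1) by (auto simp: \<T>_def)
    qed (use V finE x in \<open>auto simp: E2_def\<close>)
    also have "\<dots> \<le> (\<Sum>v\<in>V. x v * (2 ^ 2 ^ (t + 1) * \<tau>))"
    proof (intro sum_mono mult_left_mono x(1))
      fix v assume v: "v \<in> V"
      have "(\<Sum>T\<in>\<T> v. \<Prod>u\<in>T. x u) \<le> (\<Sum>T\<in>\<T> v. \<tau>)"
      proof (rule sum_mono)
        fix T assume "T \<in> \<T> v"
        then obtain w where w: "w \<in> T" "w \<in> I" and T: "T \<subseteq> B v" by (auto simp: \<T>_def)
        then have "T \<subseteq> V" "finite T" using B(1)[OF v] finB[OF v] finite_subset by auto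
        then have "(\<Prod>u\<in>T. x u) \<le> x w" using w x x1 by (intro prod_le_factor) auto
        then show "(\<Prod>u\<in>T. x u) \<le> \<tau>" using w by (simp add: I_def)
      qed
      also have "\<dots> = real (card (\<T> v)) * \<tau>" by simp
      also have "\<dots> \<le> 2 ^ 2 ^ (t + 1) * \<tau>"
      proof (rule mult_right_mono)
        have "card (\<T> v) \<le> card (Pow (B v))"
          using finB[OF v] by (intro card_mono) (auto simp: \<T>_def)
        also have "\<dots> = 2 ^ card (B v)" using finB[OF v] by (simp add: card_Pow)
        also have "\<dots> \<le> 2 ^ 2 ^ (t + 1)" using B(1)[OF v] by (intro power_increasing) auto
        finally have "real (card (\<T> v)) \<le> real (2 ^ 2 ^ (t + 1))" by (simp only: of_nat_le_iff)
        then show "real (card (\<T> v)) \<le> 2 ^ 2 ^ (t + 1)" by simp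
      qed (use \<tau> in simp)
      finally show "(\<Sum>T\<in>\<T> v. \<Prod>u\<in>T. x u) \<le> 2 ^ 2 ^ (t + 1) * \<tau>" .
    qed
    also have "\<dots> = 2 ^ 2 ^ (t + 1) * \<tau> * (\<Sum>v\<in>V. x v)"
      by (simp add: mult.commute flip: sum_distrib_right)
    finally show ?thesis .
  qed
  have b1: "edge_weight x E1 \<le> 2 ^ M * real t * 2 ^ M + c"
  proof -
    let ?e = "\<lambda>v. esym (k - 1) x (Nb v)"
    have "edge_weight x E1 \<le> (\<Sum>v\<in>I. x v * (\<Sum>T\<in>nsets (Nb v) (k - 1). \<Prod>u\<in>T. x u))"
      unfolding edge_weight_def
    proof (rule sum_prod_cover_le)
      show "finite (nsets (Nb v) (k - 1))" for v
        using finL NbL finite_subset by (intro finite_imp_finite_nsets) blast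
      show "finite F" if "F \<in> E1" for F using that Fsub by (auto simp: E1_def)
      show "\<exists>v\<in>F \<inter> I. F - {v} \<in> nsets (Nb v) (k - 1)" if F1: "F \<in> E1" for F
      proof -
        obtain v where v: "v \<in> F" "v \<in> I" "F - {v} \<subseteq> L" and F: "F \<in> E"
          using F1 by (auto simp: E1_def)
        have "F - {v} \<subseteq> Nb v"
          using v E(2)[OF F] by (auto simp: Nb_def L_def clique_def)
        then show ?thesis using v Fsub[OF F] by (intro bexI[of _ v]) (auto simp: nsets_def)
      qed
      show "0 \<le> x u" if "v \<in> I" "T \<in> nsets (Nb v) (k - 1)" "u \<in> T" for v T u
        using that x(1) by (auto simp: nsets_def Nb_def)
    qed (use finI finE x in \<open>auto simp: E1_def I_def\<close>)
    also have "\<dots> = (\<Sum>v\<in>I. x v * ?e v)" by (simp add: esym_def)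
    also have "\<dots> \<le> 2 ^ M * real t * 2 ^ M + c"
    proof -
      \<comment> \<open>At most \<open>2 ^ M\<close> sets occur as heavy neighbourhoods and each is
        shared by fewer than \<open>t\<close> vertices of \<open>U\<close>; each such vertex
        contributes at most \<open>2 ^ M\<close>.\<close>
      define U where "U = {v \<in> I. card {w \<in> I. Nb w = Nb v} < t}"
      have U: "U \<subseteq> I" "finite U" using finI by (auto simp: U_def)
      have e0: "0 \<le> ?e v" for v using x(1) by (intro esym_nonneg) (auto simp: Nb_def)
      have "(\<Sum>v\<in>U. x v * ?e v) \<le> (\<Sum>v\<in>U. 1 * 2 ^ M)"
        using U x(1) x1 e0 esymL[OF NbL] by (intro sum_mono mult_mono) (auto simp: I_def)
      also have "\<dots> = real (card U) * 2 ^ M" by simp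
      also have "\<dots> \<le> 2 ^ M * real t * 2 ^ M"
      proof (rule mult_right_mono)
        have "U \<subseteq> (\<Union>S\<in>Nb ` U. {w \<in> I. Nb w = S})" using U by auto
        then have "card U \<le> card (\<Union>S\<in>Nb ` U. {w \<in> I. Nb w = S})"
          using U finI by (intro card_mono) auto
        also have "\<dots> \<le> (\<Sum>S\<in>Nb ` U. card {w \<in> I. Nb w = S})"
          using U by (intro card_UN_le) auto
        also have "\<dots> \<le> (\<Sum>S\<in>Nb ` U. t)" by (intro sum_mono) (auto simp: U_def)
        also have "\<dots> = card (Nb ` U) * t" by simp
        also have "\<dots> \<le> card (Pow L) * t"
          using finL NbL by (intro mult_right_mono card_mono) auto
        also have "card (Pow L) = 2 ^ card L" using finL by (simp add: card_Pow)
        finally have "real (card U) \<le> real (2 ^ card L * t)" by (simp only: of_nat_le_iff)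
        also have "\<dots> \<le> 2 ^ M * real t" using pow by (simp add: mult_right_mono)
        finally show "real (card U) \<le> 2 ^ M * real t" .
      qed simp
      finally have u: "(\<Sum>v\<in>U. x v * ?e v) \<le> 2 ^ M * real t * 2 ^ M" .
      let ?X = "\<Sum>w\<in>I. x w"
      have xI: "0 \<le> x v" if "v \<in> I" for v using that x(1) by (auto simp: I_def)
      then have X0: "?X \<ge> 0" by (intro sum_nonneg)
      \<comment> \<open>A weighted average of rates with weights \<open>x v\<close>: each rate times
        \<open>?X\<close> is at most \<open>c\<close>. Stating \<open>pop\<close> as a product
        leaves only the trivial case \<open>?X = 0\<close> to be separated.\<close>
      have "(\<Sum>v\<in>I - U. x v * ?e v) \<le> c"
      proof (cases "?X = 0")
        case True
        then have "\<forall>v\<in>I. x v = 0" using xI finI by (simp add: sum_nonneg_eq_0_iff)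
        then have "(\<Sum>v\<in>I - U. x v * ?e v) = 0" by (intro sum.neutral) auto
        then show ?thesis using c by simp
      next
        case False
        have "?X * (\<Sum>v\<in>I - U. x v * ?e v) = (\<Sum>v\<in>I - U. x v * (?e v * ?X))"
          by (simp add: sum_distrib_left mult_ac del: sum_distrib_right)
        also have "\<dots> \<le> (\<Sum>v\<in>I - U. x v * c)"
          using xI pop by (intro sum_mono mult_left_mono) (auto simp: U_def)
        also have "\<dots> \<le> (\<Sum>v\<in>I. x v * c)"
          using xI c finI by (intro sum_mono2) auto
        also have "\<dots> = ?X * c" by (simp add: sum_distrib_right)
        finally show ?thesis using False X0 by simp
      qed
      moreover have "(\<Sum>v\<in>I. x v * ?e v) = (\<Sum>v\<in>I - U. x v * ?e v) + (\<Sum>v\<in>U. x v * ?e v)"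
        using U finI by (intro sum.subset_diff)
      ultimately show ?thesis using u by simp
    qed
    finally show ?thesis .
  qed
  from split b0 b1 b2 show ?thesis by simp
qed

text \<open>Below, \<open>A\<close> becomes the dominating clique of the extremal hypergraph and \<open>N\<close> its independent
  part; an edge through the remaining vertices \<open>R\<close> has either few neighbours in \<open>A\<close> or a second
  vertex of small weight outside \<open>A\<close>.\<close>

lemma edge_weight_common_neighbours:
  fixes x :: "'a \<Rightarrow> real" and G :: "'a graph"
  assumes V: "finite V" and E: "E \<subseteq> nsets V k" "\<And>F. F \<in> E \<Longrightarrow> clique F (edges G)"
    and loop: "\<And>v. {v} \<notin> edges G" and minor: "\<not> clique_minor_in G V (card A + 2)"
    and A: "A \<subseteq> V"
    and x: "\<And>v. v \<in> V \<Longrightarrow> 0 \<le> x v \<and> x v \<le> 1"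
    and small: "\<And>w. w \<in> V - A \<Longrightarrow> x w \<le> \<epsilon>" and \<epsilon>: "\<epsilon> \<ge> 0"
    and e0: "\<And>u. u \<in> A \<Longrightarrow> esym (k - 1) x (A - {u}) \<le> e0"
  defines "N \<equiv> {v \<in> V - A. \<forall>u\<in>A. {v, u} \<in> edges G}"
  assumes cN: "card A + 2 \<le> card N"
  shows "{F \<in> E. F \<subseteq> A \<union> N} \<subseteq> split_edges k A N"
    and "edge_weight x E \<le> edge_weight x {F \<in> E. F \<subseteq> A \<union> N}
      + (e0 + 2 ^ (2 ^ (card A + 3) + 1 + card A) * \<epsilon>) * (\<Sum>v\<in>V - A - N. x v)"
proof -
  define R where "R = V - A - N"
  have finA: "finite A" and finN: "finite N" and finR: "finite R" and finE: "finite E"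
    using V finite_subset[OF A] finite_subset[OF E(1)] by (auto simp: N_def R_def)
  have Vpart: "V = A \<union> N \<union> R" "A \<inter> N = {}" "R \<inter> (A \<union> N) = {}" "N \<subseteq> V" "R \<subseteq> V"
    using A by (auto simp: N_def R_def)
  have AN: "{u, p} \<in> edges G" "{p, u} \<in> edges G" if "u \<in> A" "p \<in> N" for u p
    using that by (auto simp: N_def insert_commute)
  \<comment> \<open>The two spare elements of \<open>N\<close> serve as ends of the forbidden
    configuration below, and the others still suffice for a matching with \<open>A\<close>.\<close>
  have cP: "card A \<le> card (N - {u, w})" for u w
  proof -
    have "card N - card {u, w} \<le> card (N - {u, w})" by (rule diff_card_le_card_Diff) simp
    moreover have "card {u, w} \<le> 2" by (simp add: card_insert_if)
    ultimately show ?thesis using cN by linarith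
  qed
  \<comment> \<open>One construction proves two facts: \<open>N\<close> is independent, and a vertex
    of \<open>R\<close> has at most one neighbour in \<open>N\<close>. The extra branch sets are
    \<open>{w}\<close> and either \<open>{u}\<close> or the contracted edge
    \<open>{v, u}\<close>.\<close>
  have indep: "u = w" if uw: "u \<in> N" "w \<in> N" and nb: "{u, w} \<in> edges G \<or> (\<exists>v\<in>R. {u, v} \<in> edges G \<and> {v, w} \<in> edges G)" for u w
  proof (rule ccontr)
    assume "u \<noteq> w"
    obtain U where U: "connected_in G U" "u \<in> U" "U \<subseteq> insert u R" "\<exists>z\<in>U. {z, w} \<in> edges G"
      using nb
    proof
      assume "{u, w} \<in> edges G"
      then show thesis using that[of "{u}"] by (simp add: connected_in_singleton)
    next
      assume "\<exists>v\<in>R. {u, v} \<in> edges G \<and> {v, w} \<in> edges G"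
      then obtain v where "v \<in> R" "{u, v} \<in> edges G" "{v, w} \<in> edges G" by blast
      then show thesis
        using that[of "{v, u}"] connected_in_insert[OF connected_in_singleton, of u u v G] by auto
    qed
    have "clique_minor_in G V (card A + 2)"
    proof (rule clique_minor_of_matching[where P = "N - {u, w}" and U = U and U' = "{w}"])
      show "U \<inter> {w} = {}" "U \<inter> (A \<union> (N - {u, w})) = {}" "A \<union> (N - {u, w}) \<union> U \<union> {w} \<subseteq> V"
        using U(3) uw \<open>u \<noteq> w\<close> Vpart by auto
      show "\<exists>z\<in>U. {z, v} \<in> edges G \<or> {z, p} \<in> edges G" if "v \<in> A" for v p
        using U(2) AN that uw by blast
    qed (use finA finN cP Vpart AN U uw connected_in_singleton in auto)
    with minor show False by simp
  qed
  have Fsub: "F \<subseteq> V" "finite F" "card F = k" if "F \<in> E" for F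
    using E(1) that by (auto simp: nsets_def)
  show sub: "{F \<in> E. F \<subseteq> A \<union> N} \<subseteq> split_edges k A N"
  proof
    fix F assume "F \<in> {F \<in> E. F \<subseteq> A \<union> N}"
    then have F: "F \<in> E" "F \<subseteq> A \<union> N" by auto
    have "u = v" if "u \<in> F \<inter> N" "v \<in> F \<inter> N" for u v
      using that indep E(2)[OF F(1)] unfolding clique_def by blast
    then show "F \<in> split_edges k A N" using F Fsub[OF F(1)] by (auto simp: split_edges_def nsets_def)
  qed
  \<comment> \<open>The elimination order is taken on \<open>R\<close> alone. Edges meeting
    \<open>R\<close> are charged to a vertex of \<open>R\<close>, and its neighbours in
    \<open>A\<close> and \<open>N\<close> are added by hand.\<close>
  have "\<not> clique_minor_in G R (card A + 2)"
    using minor clique_minor_in_mono[of G R _ V] Vpart by blast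
  from clique_minor_free_cover[OF finR this loop] obtain B
    where "\<forall>v\<in>R. B v \<subseteq> R \<and> card (B v) \<le> 2 ^ (card A + 2 + 1)"
    "\<forall>F\<subseteq>R. F \<noteq> {} \<and> clique F (edges G) \<longrightarrow> (\<exists>v\<in>F. F - {v} \<subseteq> B v)"
    by (elim exE conjE) (rule that)
  moreover have "card A + 2 + 1 = card A + 3" by simp
  ultimately have B: "\<And>v. v \<in> R \<Longrightarrow> B v \<subseteq> R \<and> card (B v) \<le> 2 ^ (card A + 3)"
    "\<And>F. F \<subseteq> R \<Longrightarrow> F \<noteq> {} \<Longrightarrow> clique F (edges G) \<Longrightarrow> \<exists>v\<in>F. F - {v} \<subseteq> B v"
    by (metis (no_types))+
  define ER where "ER = {F \<in> E. F \<inter> R \<noteq> {}}"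
  \<comment> \<open>Later neighbours in \<open>R\<close>, at most one neighbour in \<open>N\<close>,
    and \<open>A\<close>: these three parts are the summands of the exponent in the error
    term.\<close>
  define B' where "B' v = B v \<union> {u \<in> N. {v, u} \<in> edges G} \<union> A" for v
  define NA where "NA v = {u \<in> A. {v, u} \<in> edges G}" for v
  \<comment> \<open>If the rest of the edge lies in \<open>A\<close>, it avoids some
    \<open>u\<close> of \<open>A\<close>, as \<open>v\<close> is not in \<open>N\<close>, so the
    total is at most \<open>e0\<close>. Otherwise (\<open>\<T>2\<close>) it has a vertex outside
    \<open>A\<close>, whose entry is at most \<epsilon>.\<close>
  define \<T>1 where "\<T>1 v = nsets (NA v) (k - 1)" for v
  define \<T>2 where "\<T>2 v = {T \<in> Pow (B' v). \<not> T \<subseteq> A}" for v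
  let ?K = "(2::real) ^ (2 ^ (card A + 3) + 1 + card A)"
  have B': "finite (B' v) \<and> B' v \<subseteq> V \<and> card (B' v) \<le> 2 ^ (card A + 3) + 1 + card A" if v: "v \<in> R" for v
  proof -
    have fB: "finite (B v)" using B(1)[OF v] finR finite_subset by blast
    have "card {u \<in> N. {v, u} \<in> edges G} \<le> 1"
    proof -
      have "\<forall>u\<in>{u \<in> N. {v, u} \<in> edges G}. \<forall>w\<in>{u \<in> N. {v, u} \<in> edges G}. u = w"
        using indep v by (auto simp: insert_commute)
      then show ?thesis using finN by (simp add: card_le_Suc0_iff_eq)
    qed
    moreover have "card (B' v) \<le> card (B v) + card {u \<in> N. {v, u} \<in> edges G} + card A"
      unfolding B'_def by (meson card_Un_le add_mono order_refl order_trans)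
    ultimately have "card (B' v) \<le> 2 ^ (card A + 3) + 1 + card A"
      using B(1)[OF v] by linarith
    moreover have "finite (B' v)" using fB finN finA by (simp add: B'_def)
    moreover have "B' v \<subseteq> V" using B(1)[OF v] Vpart by (auto simp: B'_def)
    ultimately show ?thesis by blast
  qed
  have "edge_weight x ER \<le> (\<Sum>v\<in>R. x v * (\<Sum>T\<in>\<T>1 v \<union> \<T>2 v. \<Prod>u\<in>T. x u))"
    unfolding edge_weight_def
  proof (rule sum_prod_cover_le)
    show "finite (\<T>1 v \<union> \<T>2 v)" if "v \<in> R" for v
      using B'[OF that] finA by (simp add: \<T>1_def \<T>2_def NA_def)
    show "finite F" if "F \<in> ER" for F using that Fsub by (auto simp: ER_def)
    show "\<exists>v\<in>F \<inter> R. F - {v} \<in> \<T>1 v \<union> \<T>2 v" if F1: "F \<in> ER" for F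
    proof -
      have F: "F \<in> E" "F \<inter> R \<noteq> {}" using F1 by (auto simp: ER_def)
      have "clique (F \<inter> R) (edges G)" using E(2)[OF F(1)] by (rule smaller_clique) auto
      then obtain v where v: "v \<in> F" "v \<in> R" "F \<inter> R - {v} \<subseteq> B v"
        using B(2)[of "F \<inter> R"] F(2) by auto
      have adj: "{v, u} \<in> edges G" if "u \<in> F - {v}" for u
        using E(2)[OF F(1)] v that by (auto simp: clique_def)
      have "F - {v} \<in> \<T>1 v \<union> \<T>2 v"
      proof (cases "F - {v} \<subseteq> A")
        case True
        then have "F - {v} \<subseteq> NA v" using adj by (auto simp: NA_def)
        then show ?thesis using v Fsub[OF F(1)] by (simp add: \<T>1_def nsets_def)
      next
        case False
        have "F - {v} \<subseteq> B' v"
          using v(3) adj Fsub[OF F(1)] Vpart(1) by (auto simp: B'_def)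
        with False show ?thesis by (simp add: \<T>2_def)
      qed
      with v show ?thesis by blast
    qed
    show "0 \<le> x u" if "v \<in> R" "T \<in> \<T>1 v \<union> \<T>2 v" "u \<in> T" for v T u
    proof -
      have "u \<in> V" using that B'[of v] A by (auto simp: \<T>1_def \<T>2_def NA_def nsets_def)
      then show ?thesis using x by blast
    qed
  qed (use finR finE x Vpart in \<open>auto simp: ER_def\<close>)
  also have "\<dots> \<le> (\<Sum>v\<in>R. x v * (e0 + ?K * \<epsilon>))"
  proof (intro sum_mono mult_left_mono)
    fix v assume v: "v \<in> R"
    then show "0 \<le> x v" using x Vpart by auto
    have "(\<Sum>T\<in>\<T>1 v \<union> \<T>2 v. \<Prod>u\<in>T. x u) = (\<Sum>T\<in>\<T>1 v. \<Prod>u\<in>T. x u) + (\<Sum>T\<in>\<T>2 v. \<Prod>u\<in>T. x u)"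
      using B'[OF v] finA
      by (intro sum.union_disjoint) (auto simp: \<T>1_def \<T>2_def NA_def nsets_def)
    also have "(\<Sum>T\<in>\<T>1 v. \<Prod>u\<in>T. x u) \<le> e0"
    proof -
      obtain u where u: "u \<in> A" "{v, u} \<notin> edges G" using v by (auto simp: R_def N_def)
      then have "esym (k - 1) x (NA v) \<le> esym (k - 1) x (A - {u})"
        using finA A x by (intro esym_mono) (auto simp: NA_def)
      then show ?thesis using e0[OF u(1)] by (simp add: \<T>1_def esym_def)
    qed
    also have "(\<Sum>T\<in>\<T>2 v. \<Prod>u\<in>T. x u) \<le> ?K * \<epsilon>"
    proof -
      have "(\<Sum>T\<in>\<T>2 v. \<Prod>u\<in>T. x u) \<le> (\<Sum>T\<in>\<T>2 v. \<epsilon>)"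
      proof (rule sum_mono)
        fix T assume "T \<in> \<T>2 v"
        then obtain w where w: "w \<in> T" "w \<notin> A" and T: "T \<subseteq> B' v" by (auto simp: \<T>2_def)
        then have "T \<subseteq> V" "finite T" using B'[OF v] finite_subset by blast+
        then have "(\<Prod>u\<in>T. x u) \<le> x w" using w x by (intro prod_le_factor) auto
        then show "(\<Prod>u\<in>T. x u) \<le> \<epsilon>" using small[of w] w \<open>T \<subseteq> V\<close> by force
      qed
      also have "\<dots> = real (card (\<T>2 v)) * \<epsilon>" by simp
      also have "\<dots> \<le> ?K * \<epsilon>"
      proof (rule mult_right_mono[OF _ \<epsilon>])
        have "card (\<T>2 v) \<le> card (Pow (B' v))"
          using B'[OF v] by (intro card_mono) (auto simp: \<T>2_def)
        also have "\<dots> = 2 ^ card (B' v)" using B'[OF v] by (simp add: card_Pow)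
        also have "\<dots> \<le> 2 ^ (2 ^ (card A + 3) + 1 + card A)"
          using B'[OF v] by (intro power_increasing) auto
        finally have "real (card (\<T>2 v)) \<le> real (2 ^ (2 ^ (card A + 3) + 1 + card A))"
          by (simp only: of_nat_le_iff)
        then show "real (card (\<T>2 v)) \<le> ?K" by simp
      qed
      finally show ?thesis .
    qed
    finally show "(\<Sum>T\<in>\<T>1 v \<union> \<T>2 v. \<Prod>u\<in>T. x u) \<le> e0 + ?K * \<epsilon>" by simp
  qed
  also have "\<dots> = (e0 + ?K * \<epsilon>) * (\<Sum>v\<in>R. x v)"
    by (simp add: mult.commute flip: sum_distrib_right)
  finally have ER: "edge_weight x ER \<le> (e0 + ?K * \<epsilon>) * (\<Sum>v\<in>R. x v)" .
  have "F \<subseteq> A \<union> N" if "F \<in> E" "F \<inter> R = {}" for F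
    using Fsub(1)[OF that(1)] that(2) Vpart(1) by blast
  then have "E = {F \<in> E. F \<subseteq> A \<union> N} \<union> ER"
    by (auto simp: ER_def)
  then have "edge_weight x E = edge_weight x ({F \<in> E. F \<subseteq> A \<union> N} \<union> ER)" by simp
  also have "\<dots> \<le> edge_weight x {F \<in> E. F \<subseteq> A \<union> N} + edge_weight x ER"
    using finE subsetD[OF Fsub(1)] x by (intro edge_weight_union_le) (auto simp: ER_def)
  finally show "edge_weight x E \<le> edge_weight x {F \<in> E. F \<subseteq> A \<union> N}
      + (e0 + ?K * \<epsilon>) * (\<Sum>v\<in>V - A - N. x v)"
    using ER unfolding R_def by simp
qed

section \<open>Zero entries and recognition of B up to isomorphism\<close>

lemma esym_zero_entry:
  assumes "finite A" "x u = 0"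
  shows "esym j x A = esym j x (A - {u})"
  unfolding esym_def
proof (rule sum.mono_neutral_right)
  show "\<forall>T\<in>nsets A j - nsets (A - {u}) j. (\<Prod>v\<in>T. x v) = 0"
  proof
    fix T assume "T \<in> nsets A j - nsets (A - {u}) j"
    then have "finite T" "u \<in> T" by (auto simp: nsets_def)
    then show "(\<Prod>v\<in>T. x v) = 0" using assms(2) by (intro prod_zero) auto
  qed
qed (use assms in \<open>auto simp: nsets_def\<close>)

lemma split_edges_image:
  assumes "inj_on f (A \<union> N)"
  shows "(`) f ` split_edges k A N = split_edges k (f ` A) (f ` N)"
proof -
  have inj: "f u = f v \<longleftrightarrow> u = v" if "u \<in> A \<union> N" "v \<in> A \<union> N" for u v
    using assms that by (auto simp: inj_on_def)
  have *: "f ` F \<in> split_edges k (f ` A) (f ` N) \<longleftrightarrow> F \<in> split_edges k A N" if F: "F \<subseteq> A \<union> N" for F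
  proof -
    have "inj_on f F" using assms F inj_on_subset by blast
    then have "finite (f ` F) = finite F" "card (f ` F) = card F"
      by (simp_all add: finite_image_iff card_image)
    moreover have "f ` F \<subseteq> f ` A \<union> f ` N" using F by blast
    moreover have "v \<in> N \<longleftrightarrow> f v \<in> f ` N" if "v \<in> F" for v
      using inj[of v] that F by blast
    then have "f ` F \<inter> f ` N = f ` (F \<inter> N)" by blast
    moreover have "(\<forall>u\<in>f ` (F \<inter> N). \<forall>v\<in>f ` (F \<inter> N). u = v) \<longleftrightarrow> (\<forall>u\<in>F \<inter> N. \<forall>v\<in>F \<inter> N. u = v)"
    proof -
      have "(\<forall>u\<in>F \<inter> N. \<forall>v\<in>F \<inter> N. f u = f v) \<longleftrightarrow> (\<forall>u\<in>F \<inter> N. \<forall>v\<in>F \<inter> N. u = v)"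
        using inj by (intro ball_cong refl) auto
      then show ?thesis by simp
    qed
    ultimately show ?thesis using F by (simp add: split_edges_def nsets_def)
  qed
  show ?thesis
  proof (intro equalityI subsetI)
    fix F' assume "F' \<in> (`) f ` split_edges k A N"
    then obtain F where F: "F' = f ` F" "F \<in> split_edges k A N" by blast
    then have "F \<subseteq> A \<union> N" by (simp add: split_edges_def nsets_def)
    from *[OF this] F show "F' \<in> split_edges k (f ` A) (f ` N)" by simp
  next
    fix F' assume F': "F' \<in> split_edges k (f ` A) (f ` N)"
    then have "F' \<subseteq> f ` (A \<union> N)" by (auto simp: split_edges_def nsets_def)
    then obtain F where "F \<subseteq> A \<union> N" "F' = f ` F" by (meson subset_image_iff)
    then show "F' \<in> (`) f ` split_edges k A N" using F' * by blast
  qed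
qed

lemma hypergraph_iso_B_hypergraph:
  assumes "finite A" "finite N" "A \<inter> N = {}" "vertices H = A \<union> N" "edges H = split_edges k A N"
    "card A = t - 2" "card N = n - (t - 2)"
  shows "hypergraph_iso H (B_hypergraph k n t)"
proof -
  obtain g where g: "bij_betw g A {..<t - 2}"
    using assms(1,6) by (metis ex_bij_betw_finite_nat lessThan_atLeast0)
  obtain h where h: "bij_betw h N {..<n - (t - 2)}"
    using assms(2,7) by (metis ex_bij_betw_finite_nat lessThan_atLeast0)
  define f where "f v = (if v \<in> A then Inl (g v) else Inr (h v) :: nat + nat)" for v
  have fA: "f ` A = Inl ` {..<t - 2}"
    using g by (auto simp: f_def bij_betw_def image_image[symmetric])
  have "f ` N = (\<lambda>v. Inr (h v)) ` N"
    using assms(3) by (intro image_cong) (auto simp: f_def)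
  then have fN: "f ` N = Inr ` {..<n - (t - 2)}"
    using h by (metis bij_betw_def image_image)
  have inj: "inj_on f (A \<union> N)"
    using g h by (auto simp: inj_on_def f_def bij_betw_def)
  have "bij_betw f (vertices H) (vertices (B_hypergraph k n t))"
    using inj fA fN assms(4) by (simp add: bij_betw_def vertices_B_hypergraph image_Un)
  moreover have "(`) f ` edges H = edges (B_hypergraph k n t)"
    unfolding assms(5) split_edges_image[OF inj] fA fN edges_B_hypergraph ..
  ultimately show ?thesis unfolding hypergraph_iso_def by blast
qed

text \<open>\<open>\<theta> = ((k - 1) / a) powr (1 / k)\<close> is the limiting ratio of the entries of the principal eigenvector
  (up to the factor \<open>n powr (1 / k)\<close>); with it the two binomial coefficients in \<open>esym_mult_le\<close>
  balance for sets of size \<open>a\<close>.\<close>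

lemma esym_mult_le_B_constant:
  fixes x :: "'a \<Rightarrow> real"
  assumes k: "k \<ge> 3" and t: "t \<ge> k + 1" and S: "finite S" "\<And>v. v \<in> S \<Longrightarrow> 0 \<le> x v" and y: "0 \<le> y"
  shows "card S = t - 2 \<Longrightarrow>
      real k * (esym (k - 1) x S * y) \<le> B_constant k t * ((\<Sum>v\<in>S. x v ^ k) + y ^ k)"
    and "card S < t - 2 \<Longrightarrow>
      real k * (esym (k - 1) x S * y)
        \<le> (1 - real (k - 2) / real (t - 3)) * B_constant k t * ((\<Sum>v\<in>S. x v ^ k) + y ^ k)"
proof -
  define a where "a = t - 2"
  let ?p = "real ((a - 1) choose (k - 2))" and ?C = "real (a choose (k - 1))"
  let ?W = "\<Sum>v\<in>S. x v ^ k" and ?e = "esym (k - 1) x S"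
  define \<gamma> where "\<gamma> = 1 - real (k - 2) / real (t - 3)"
  have a: "a \<ge> k - 1" "a \<ge> 2" using k t by (auto simp: a_def)
  have t3: "t - 3 = a - 1" by (simp add: a_def)
  define \<theta> where "\<theta> = root k (real (k - 1) / real a)"
  have k0: "k > 0" using k by simp
  have \<theta>k: "\<theta> ^ k = real (k - 1) / real a" using k by (simp add: \<theta>_def)
  have \<theta>0: "\<theta> > 0" unfolding \<theta>_def using k a by (intro real_root_gt_zero) auto
  have p0: "?p > 0" using a by (simp add: zero_less_binomial_iff)
  have bin: "(k - 1) * (a choose (k - 1)) = a * ((a - 1) choose (k - 2))"
    using times_binomial_minus1_eq[of "k - 1" a] k by (simp add: diff_diff_eq numeral_2_eq_2)
  have Cp: "?C * \<theta> ^ k = ?p"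
  proof -
    have "real (k - 1) * ?C = real a * ?p" using bin by (metis of_nat_mult)
    then show ?thesis using a by (simp add: \<theta>k field_simps)
  qed
  \<comment> \<open>Compared through \<open>k\<close>-th powers: with the balancing \<theta> the
    AM-GM bound has constant ?p / \<theta>, which is \<open>B_constant\<close>.\<close>
  have B: "B_constant k t * \<theta> = ?p"
  proof -
    have "(B_constant k t * \<theta>) ^ k = ?p ^ (k - 1) * (?C * \<theta> ^ k)"
      using B_constant_power[of k t] k t by (simp add: power_mult_distrib a_def t3[symmetric])
    also have "\<dots> = ?p ^ k" unfolding Cp using k0 by (rule power_minus_mult)
    finally have eq: "(B_constant k t * \<theta>) ^ k = ?p ^ k" .
    show ?thesis
      by (rule power_eq_imp_eq_base[OF eq]) (use \<theta>0 k0 in \<open>auto simp: B_constant_def\<close>)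
  qed
  have W0: "?W \<ge> 0" using S by (intro sum_nonneg) auto
  have base: "\<theta> * (real k * (?e * y))
      \<le> real ((card S - 1) choose (k - 2)) * ?W + real (card S choose (k - 1)) * \<theta> ^ k * y ^ k"
    using esym_mult_le[of S k x y \<theta>] S y k \<theta>0 by (simp add: mult_ac)
  { assume c: "card S = t - 2"
    have "\<theta> * (real k * (?e * y)) \<le> ?p * ?W + ?p * y ^ k"
      using base c Cp by (simp add: a_def)
    also have "\<dots> = \<theta> * (B_constant k t * (?W + y ^ k))"
      unfolding B[symmetric] by (simp add: algebra_simps)
    finally show "real k * (?e * y) \<le> B_constant k t * (?W + y ^ k)" using \<theta>0 by simp }
  assume c: "card S < t - 2"
  have a1: "real (a - 1) > 0" using a by simp
  \<comment> \<open>\<gamma> is the ratio of \<open>(a - 2) choose (k - 2)\<close> to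
    \<open>(a - 1) choose (k - 2)\<close>, the factor lost in the first coefficient when
    \<open>S\<close> has one element less. The second coefficient loses the factor (a - (k - 1)) /
    a, which is no larger.\<close>
  have \<gamma>: "\<gamma> = real (a - 1 - (k - 2)) / real (a - 1)"
    using a k by (simp add: \<gamma>_def t3 of_nat_diff field_simps)
  have 1: "real ((card S - 1) choose (k - 2)) \<le> \<gamma> * ?p"
  proof -
    have "(a - 1 - (k - 2)) * ((a - 1) choose (k - 2)) = (a - 1) * ((a - 1 - 1) choose (k - 2))"
      using binomial_absorb_comp[of "a - 1" "k - 2"] by simp
    then have "real (a - 1 - (k - 2)) * ?p = real (a - 1) * real ((a - 1 - 1) choose (k - 2))"
      by (metis of_nat_mult)
    then have "\<gamma> * ?p = real ((a - 1 - 1) choose (k - 2))"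
      unfolding \<gamma> using a1 by (simp add: field_simps)
    moreover have "(card S - 1) choose (k - 2) \<le> (a - 1 - 1) choose (k - 2)"
      using c by (intro binomial_right_mono) (simp add: a_def)
    ultimately show ?thesis by simp
  qed
  have 2: "real (card S choose (k - 1)) * \<theta> ^ k \<le> \<gamma> * ?p"
  proof -
    have "(a - (k - 1)) * (a choose (k - 1)) = a * ((a - 1) choose (k - 1))"
      using binomial_absorb_comp[of a "k - 1"] by simp
    then have "real (a - (k - 1)) * ?C = real a * real ((a - 1) choose (k - 1))"
      by (metis of_nat_mult)
    then have eq: "real ((a - 1) choose (k - 1)) = real (a - (k - 1)) / real a * ?C"
      using a by (simp add: field_simps)
    have "real (a - (k - 1)) / real a \<le> \<gamma>"
    proof -
      have "a - 1 - (k - 2) = a - (k - 1)" using k by simp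
      then show ?thesis unfolding \<gamma> using a by (simp add: frac_le)
    qed
    then have "real ((a - 1) choose (k - 1)) * \<theta> ^ k \<le> \<gamma> * (?C * \<theta> ^ k)"
      unfolding eq mult.assoc using \<theta>0 by (intro mult_right_mono) auto
    moreover have "card S choose (k - 1) \<le> (a - 1) choose (k - 1)"
      using c by (intro binomial_right_mono) (simp add: a_def)
    then have "real (card S choose (k - 1)) * \<theta> ^ k \<le> real ((a - 1) choose (k - 1)) * \<theta> ^ k"
      using \<theta>0 by (intro mult_right_mono) auto
    ultimately show ?thesis unfolding Cp by linarith
  qed
  have "\<theta> * (real k * (?e * y)) \<le> \<gamma> * ?p * ?W + \<gamma> * ?p * y ^ k"
    using base mult_right_mono[OF 1 W0] mult_right_mono[OF 2, of "y ^ k"] y by simp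
  also have "\<dots> = \<theta> * (\<gamma> * B_constant k t * (?W + y ^ k))"
    unfolding B[symmetric] by (simp add: algebra_simps)
  finally show "real k * (?e * y) \<le> (1 - real (k - 2) / real (t - 3)) * B_constant k t * (?W + y ^ k)"
    using \<theta>0 by (simp add: \<gamma>_def)
qed

section \<open>Extremality\<close>

text \<open>Replaces up to \<open>n\<close> vertices by one virtual entry, their scaled total,
  without increasing the norm.\<close>

lemma sum_le_powr:
  fixes x :: "'a \<Rightarrow> real"
  assumes S: "finite S" "card S \<le> n" "\<And>v. v \<in> S \<Longrightarrow> 0 \<le> x v" and k: "k \<ge> 2" and n: "n > 0"
  shows "((\<Sum>v\<in>S. x v) / real n powr ((real k - 1) / real k)) ^ k \<le> (\<Sum>v\<in>S. x v ^ k)"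
proof -
  have "(\<Sum>v\<in>S. x v) ^ k \<le> real (card S) ^ (k - 1) * (\<Sum>v\<in>S. x v ^ k)"
    using S k by (intro power_sum_le) auto
  also have "\<dots> \<le> real n ^ (k - 1) * (\<Sum>v\<in>S. x v ^ k)"
    using S by (intro mult_right_mono power_mono sum_nonneg) auto
  also have "real n ^ (k - 1) = (real n powr ((real k - 1) / real k)) ^ k"
    using powr_ratio_power[of "real n" k] k n by simp
  finally show ?thesis
    using n by (simp add: power_divide divide_le_eq mult.commute)
qed

text \<open>The comparison for a single \<open>n\<close>, with every demand on its size made
  explicit. \<delta> is the tolerated relative loss against the optimum \<open>c * Q\<close>,
  \<epsilon> bounds the entries outside the clique side, \<tau> separates light from heavy, and
  \<open>M\<close> bounds the number of heavy vertices.\<close>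

lemma spectral_radius_ge_B_hypergraph_imp_iso:
  fixes H :: "'a hypergraph" and \<delta> \<epsilon> \<tau> r :: real
  assumes k: "k \<ge> 3" and t: "t \<ge> k + 1" and n: "n > t - 2"
    and H: "H \<in> minor_free_shadow_class k (complete_graph t) n"
  defines "c \<equiv> B_constant k t" and "\<gamma> \<equiv> 1 - real (k - 2) / real (t - 3)"
    and "Q \<equiv> real n powr ((real k - 1) / real k)"
  assumes \<delta>: "0 < \<delta>" "\<delta> \<le> \<epsilon> ^ k" "\<delta> \<le> (1 - \<gamma>) / 2"
    and \<epsilon>: "0 < \<epsilon>" "2 ^ (2 ^ (t + 1) + 1 + (t - 2)) * \<epsilon> * real k < (1 - \<gamma>) / 2 * c"
    and \<tau>: "0 < \<tau>" "\<tau> \<le> \<epsilon>" "2 ^ 2 ^ (t + 1) * \<tau> * real k \<le> \<delta> / 4 * c" "1 / \<tau> ^ k \<le> real M"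
    and large: "real k * (2 ^ M + 2 ^ M * real t * 2 ^ M) < \<delta> / 4 * c * Q" "(1 - \<delta> / 4) * c * Q < r"
    and r: "real ((t - 2 - 1) choose (k - 1)) < r" "B_equation k (t - 2) n r"
    and le: "r \<le> spectral_radius k H"
  shows "spectral_radius k H = r \<and> hypergraph_iso H (B_hypergraph k n t)"
proof -
  define V E G where "V = vertices H" and "E = edges H" and "G = shadow H"
  have unif: "uniform_hypergraph k H" and cV: "card V = n" and "\<not> has_minor G (complete_graph t)"
    using H by (auto simp: minor_free_shadow_class_def V_def G_def)
  moreover have "vertices G = V" by (simp add: G_def V_def shadow_def)
  ultimately have minor: "\<not> clique_minor_in G V t" using has_minor_complete_graph[of G t] by auto
  have V: "finite V" and E: "E \<subseteq> nsets V k"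
    using unif by (auto simp: uniform_hypergraph_def V_def E_def)
  have loop: "{v} \<notin> edges G" for v by (auto simp: G_def shadow_def)
  have cl: "clique F (edges G)" if "F \<in> E" for F
    using that unfolding clique_def G_def shadow_def E_def by auto
  have "V \<noteq> {}" using cV n by auto
  then obtain x where x: "\<And>v. v \<in> V \<Longrightarrow> 0 \<le> x v" "(\<Sum>v\<in>V. x v ^ k) = 1"
    and \<rho>: "spectral_radius k H = real k * edge_weight x E"
    using spectral_radius_attained[OF unif, of thesis] k by (auto simp: V_def E_def)
  have k2: "k \<ge> 2" and k0: "k > 0" and n0: "n > 0" using k n by auto
  have \<gamma>1: "\<gamma> < 1" using k t by (simp add: \<gamma>_def)
  have c0: "c > 0" using k t by (simp add: c_def B_constant_def zero_less_binomial_iff)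
  have Q0: "Q > 0" using n0 by (simp add: Q_def)
  have \<gamma>0: "\<gamma> \<ge> 0" using k t by (simp add: \<gamma>_def)
  have \<delta>1: "\<delta> < 1" using \<delta>(3) \<gamma>0 by simp
  define I where "I = {v \<in> V. x v < \<tau>}"
  define Nb where "Nb = (\<lambda>v. {u \<in> V. \<tau> \<le> x u \<and> {v, u} \<in> edges G})"
  define X where "X = (\<Sum>w\<in>I. x w)"
  \<comment> \<open>Otherwise the main term is at most (1 - \<delta>) c Q. The bounded terms and the
    edges with two light vertices add at most \<delta>/4 c Q each, and the total stays below
    \<open>r\<close>.\<close>
  have "\<exists>v\<in>I. t \<le> card {w \<in> I. Nb w = Nb v} \<and> (1 - \<delta>) * c * Q / real k < esym (k - 1) x (Nb v) * X"
  proof (rule ccontr)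
    assume "\<not> ?thesis"
    then have "edge_weight x E \<le> 2 ^ M + 2 ^ M * real t * 2 ^ M + (1 - \<delta>) * c * Q / real k
        + 2 ^ 2 ^ (t + 1) * \<tau> * (\<Sum>v\<in>V. x v)"
      using V E cl loop minor k0 x \<tau>(1,4) \<delta>1 c0 Q0
      by (intro edge_weight_light_heavy[where G = G]) (auto simp: I_def Nb_def X_def not_le not_less)
    then have "real k * edge_weight x E \<le> real k * (2 ^ M + 2 ^ M * real t * 2 ^ M + (1 - \<delta>) * c * Q / real k
        + 2 ^ 2 ^ (t + 1) * \<tau> * (\<Sum>v\<in>V. x v))"
      by (intro mult_left_mono) auto
    also have "\<dots> = real k * (2 ^ M + 2 ^ M * real t * 2 ^ M) + (1 - \<delta>) * c * Q
        + (2 ^ 2 ^ (t + 1) * \<tau> * real k) * (\<Sum>v\<in>V. x v)"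
    proof -
      have "real k * ((1 - \<delta>) * c * Q / real k) = (1 - \<delta>) * c * Q" using k0 by simp
      then show ?thesis by (simp only: distrib_left mult_ac)
    qed
    also have "\<dots> \<le> \<delta> / 4 * c * Q + (1 - \<delta>) * c * Q + \<delta> / 4 * c * Q"
    proof -
      have "((\<Sum>v\<in>V. x v) / Q) ^ k \<le> 1 ^ k"
        using sum_le_powr[of V n x k] V x cV k2 n0 by (simp add: Q_def)
      then have "(\<Sum>v\<in>V. x v) / Q \<le> 1"
        using k0 Q0 x(1) by (subst (asm) power_mono_iff) (auto intro!: divide_nonneg_pos sum_nonneg)
      then have "(\<Sum>v\<in>V. x v) \<le> Q" using Q0 by simp
      then have "(2 ^ 2 ^ (t + 1) * \<tau> * real k) * (\<Sum>v\<in>V. x v) \<le> (\<delta> / 4 * c) * Q"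
        by (rule mult_mono[OF \<tau>(3)]) (use x(1) \<delta>(1) c0 in \<open>auto intro: sum_nonneg\<close>)
      then show ?thesis using large(1) by linarith
    qed
    also have "\<dots> \<le> (1 - \<delta> / 4) * c * Q"
    proof -
      have "\<delta> / 4 * c * Q + (1 - \<delta>) * c * Q + \<delta> / 4 * c * Q = (1 - \<delta> / 2) * (c * Q)"
        by (simp add: field_simps)
      also have "\<dots> \<le> (1 - \<delta> / 4) * (c * Q)"
        using \<delta> c0 Q0 by (intro mult_right_mono) auto
      finally show ?thesis by (simp add: mult.assoc)
    qed
    finally show False using large(2) le \<rho> by simp
  qed
  then obtain v0 where v0: "v0 \<in> I" "t \<le> card {w \<in> I. Nb w = Nb v0}"
    "(1 - \<delta>) * c * Q / real k < esym (k - 1) x (Nb v0) * X" by blast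
  define S where "S = Nb v0"
  define P where "P = {w \<in> I. Nb w = S}"
  \<comment> \<open>The virtual entry for all light vertices. Together with \<open>S\<close> it has
    norm at most 1 (\<open>mass\<close>), and its weight comes within a factor 1 - \<delta> of the
    optimum \<open>c\<close> (\<open>ey\<close>).\<close>
  define y where "y = X / Q"
  let ?e = "esym (k - 1) x S"
  have finI: "finite I" and finP: "finite P" and finS: "finite S"
    using V by (auto simp: I_def P_def S_def Nb_def)
  have SV: "S \<subseteq> V" and IV: "I \<subseteq> V" and SI: "S \<inter> I = {}" and PI: "P \<subseteq> I"
    by (auto simp: S_def I_def Nb_def P_def)
  have SP: "{p, s} \<in> edges G" if "p \<in> P" "s \<in> S" for p s
    using that by (auto simp: P_def Nb_def)
  have X0: "X \<ge> 0" using x(1) IV by (auto simp: X_def intro!: sum_nonneg)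
  have y0: "y \<ge> 0" using X0 Q0 by (simp add: y_def)
  have ey: "(1 - \<delta>) * c < real k * (?e * y)"
    using v0(3) k0 Q0 by (simp add: y_def S_def[symmetric] field_simps)
  have yk: "y ^ k \<le> (\<Sum>v\<in>I. x v ^ k)"
    using sum_le_powr[of I n x k] finI card_mono[OF V IV] cV x(1) IV k2 n0
    by (auto simp: y_def X_def Q_def)
  have mass: "(\<Sum>v\<in>S. x v ^ k) + y ^ k \<le> 1 - (\<Sum>v\<in>V - S - I. x v ^ k)"
  proof -
    have "(\<Sum>v\<in>V. x v ^ k) = (\<Sum>v\<in>V - S - I. x v ^ k) + (\<Sum>v\<in>I. x v ^ k) + (\<Sum>v\<in>S. x v ^ k)"
      using V SV IV SI by (subst sum.subset_diff[OF SV V], subst sum.subset_diff[of I "V - S"]) auto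
    then show ?thesis using yk x(2) by simp
  qed
  have rest: "(\<Sum>v\<in>V - S - I. x v ^ k) \<ge> 0" using x(1) by (intro sum_nonneg) auto
  have y1: "y \<le> 1"
  proof -
    have "(\<Sum>v\<in>S. x v ^ k) \<ge> 0" using x(1) SV by (intro sum_nonneg) auto
    then have "y ^ k \<le> 1 ^ k" using mass rest by simp
    then show ?thesis using k0 y0 by (subst (asm) power_mono_iff) auto
  qed
  have small: "real k * (esym (k - 1) x T * y) \<le> \<gamma> * c" if T: "T \<subseteq> S" "card T < t - 2" for T
  proof -
    have "real k * (esym (k - 1) x T * y) \<le> \<gamma> * c * ((\<Sum>v\<in>T. x v ^ k) + y ^ k)"
      unfolding \<gamma>_def c_def
      using T finS finite_subset x(1) SV y0 by (intro esym_mult_le_B_constant(2)[OF k t]) auto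
    also have "\<dots> \<le> \<gamma> * c * 1"
    proof (rule mult_left_mono)
      have "(\<Sum>v\<in>T. x v ^ k) \<le> (\<Sum>v\<in>S. x v ^ k)"
        using finS T x(1) SV by (intro sum_mono2) auto
      then show "(\<Sum>v\<in>T. x v ^ k) + y ^ k \<le> 1" using mass rest by simp
    qed (use \<gamma>0 c0 in simp)
    finally show ?thesis by simp
  qed
  have gap: "\<gamma> * c + (1 - \<gamma>) / 2 * c \<le> (1 - \<delta>) * c"
  proof -
    have "\<gamma> + (1 - \<gamma>) / 2 \<le> 1 - \<delta>" using \<delta>(3) by (simp add: field_simps)
    then have "(\<gamma> + (1 - \<gamma>) / 2) * c \<le> (1 - \<delta>) * c" using c0 by (intro mult_right_mono) auto
    then show ?thesis by (simp add: algebra_simps)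
  qed
  have gap0: "(1 - \<gamma>) / 2 * c > 0" using \<gamma>1 c0 by simp
  have cS: "card S = t - 2"
  proof (rule antisym)
    show "t - 2 \<le> card S"
    proof (rule ccontr)
      assume "\<not> t - 2 \<le> card S"
      then have "real k * (?e * y) \<le> \<gamma> * c" by (intro small) auto
      then show False using ey gap gap0 by linarith
    qed
    show "card S \<le> t - 2"
    proof (rule ccontr)
      assume "\<not> card S \<le> t - 2"
      then obtain A where A: "A \<subseteq> S" "card A = t - 2" by (meson nat_le_linear obtain_subset_with_card_n)
      then obtain s where s: "s \<in> S" "s \<notin> A" using \<open>\<not> card S \<le> t - 2\<close> by (metis order.refl subsetI subset_antisym)
      have v0P: "v0 \<in> P" using v0(1) by (simp add: P_def S_def)
      have "clique_minor_in G V (card A + 2)"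
      \<comment> \<open>The surplus element \<open>s\<close> of \<open>S\<close> and one vertex
        \<open>v0\<close> of \<open>P\<close> are the two extra branch sets; at least t - 1 vertices
        of \<open>P\<close> remain for the matching.\<close>
      proof (rule clique_minor_of_matching[where P = "P - {v0}" and U = "{s}" and U' = "{v0}"])
        have "card (P - {v0}) = card P - 1" using finP v0P by simp
        then show "card A \<le> card (P - {v0})" using v0(2) A k t by (simp add: P_def S_def)
        show "{u, p} \<in> edges G" if "u \<in> A" "p \<in> P - {v0}" for u p
          using SP[of p u] that A by (auto simp: insert_commute)
        show "\<exists>z\<in>{s}. {z, u} \<in> edges G \<or> {z, p} \<in> edges G" if "p \<in> P - {v0}" for u p
          using SP[of p s] that s by (auto simp: insert_commute)
        show "\<exists>z\<in>{v0}. {z, u} \<in> edges G \<or> {z, p} \<in> edges G" if "u \<in> A" for u p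
          using SP[of v0 u] that A v0P by auto
        show "\<exists>a\<in>{s}. \<exists>b\<in>{v0}. {a, b} \<in> edges G"
          using SP[of v0 s] s v0P by (auto simp: insert_commute)
      qed (use A s v0P PI SI SV IV finP finS finite_subset connected_in_singleton in auto)
      moreover have "card A + 2 = t" using A k t by simp
      ultimately show False using minor by simp
    qed
  qed
  have ypos: "y > 0"
  proof -
    have "(1 - \<delta>) * c > 0" using \<delta>1 c0 by simp
    then have "real k * (?e * y) \<noteq> 0" using ey by linarith
    then show ?thesis using y0 by auto
  qed
  have x1: "x v \<le> 1" if "v \<in> V" for v
    using entry_le_1[of V v x k] V that x k0 by blast
  have off: "x w \<le> \<epsilon>" if w: "w \<in> V - S" for w
  proof (cases "w \<in> I")
    case True
    then show ?thesis using \<tau>(2) by (simp add: I_def)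
  next
    case False
    \<comment> \<open>A heavy vertex outside \<open>S\<close> takes \<open>x w ^ k\<close> away from
      the norm available to \<open>S\<close> and \<open>y\<close>, while \<open>ey\<close> leaves a
      slack of at most \<delta>, hence at most \<open>\<epsilon> ^ k\<close>.\<close>
    then have "x w ^ k \<le> (\<Sum>v\<in>V - S - I. x v ^ k)"
      using w x(1) V by (intro member_le_sum[of w _ "\<lambda>v. x v ^ k"]) auto
    then have "(\<Sum>v\<in>S. x v ^ k) + y ^ k \<le> 1 - x w ^ k" using mass by simp
    then have "c * ((\<Sum>v\<in>S. x v ^ k) + y ^ k) \<le> c * (1 - x w ^ k)"
      using c0 by (intro mult_left_mono) auto
    moreover have "real k * (?e * y) \<le> c * ((\<Sum>v\<in>S. x v ^ k) + y ^ k)"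
      unfolding c_def using finS x(1) SV y0 cS by (intro esym_mult_le_B_constant(1)[OF k t]) auto
    ultimately have "c * (1 - \<delta>) \<le> c * (1 - x w ^ k)" using ey by (simp add: mult.commute)
    then have "x w ^ k \<le> \<epsilon> ^ k" using c0 \<delta>(2) by simp
    then show ?thesis using k0 x(1) w \<epsilon>(1) by (subst (asm) power_mono_iff) auto
  qed
  \<comment> \<open>The bound in \<open>small\<close>, divided by \<open>real k * y\<close>: the
    rate obtainable from a proper subset of \<open>S\<close>.\<close>
  define e0 where "e0 = \<gamma> * c / (real k * y)"
  have e0: "esym (k - 1) x (S - {u}) \<le> e0" if "u \<in> S" for u
  proof -
    have "card (S - {u}) < t - 2" using finS that cS k t by simp
    then have "real k * (esym (k - 1) x (S - {u}) * y) \<le> \<gamma> * c" by (intro small) auto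
    then show ?thesis using ypos k0 by (simp add: e0_def field_simps)
  qed
  let ?K = "(2::real) ^ (2 ^ (t + 1) + 1 + (t - 2))"
  \<comment> \<open>Half of the gap between \<gamma> and 1 is consumed by \<delta>; the other half
    absorbs the \<epsilon>-term, because \<open>y\<close> is at most 1.\<close>
  have lt: "e0 + ?K * \<epsilon> < ?e"
  proof -
    have "(e0 + ?K * \<epsilon>) * (real k * y) = \<gamma> * c + (?K * \<epsilon> * real k) * y"
      using ypos k0 by (simp add: e0_def field_simps)
    also have "\<dots> \<le> \<gamma> * c + (?K * \<epsilon> * real k) * 1"
      using y1 \<epsilon>(1) by (intro add_left_mono mult_left_mono) auto
    also have "\<dots> < \<gamma> * c + (1 - \<gamma>) / 2 * c" using \<epsilon>(2) by simp
    also have "\<dots> < ?e * (real k * y)" using gap ey by (simp add: mult_ac)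
    finally show ?thesis using ypos k0 by (simp add: mult_less_cancel_right)
  qed
  have S0: "0 < (\<Sum>v\<in>S. x v ^ k)"
  proof (rule ccontr)
    assume "\<not> ?thesis"
    moreover have "(\<Sum>v\<in>S. x v ^ k) \<ge> 0" using x(1) SV by (intro sum_nonneg) auto
    ultimately have "(\<Sum>v\<in>S. x v ^ k) = 0" by simp
    then have "\<forall>v\<in>S. x v ^ k = 0" using x(1) SV finS by (subst (asm) sum_nonneg_eq_0_iff) auto
    then have "?e = real (card S choose (k - 1)) * 0 ^ (k - 1)"
      using finS by (intro esym_const) auto
    then have "?e = 0" using k by (simp add: power_0_left)
    moreover have "e0 \<ge> 0" using \<gamma>0 c0 ypos by (simp add: e0_def)
    moreover have "?K * \<epsilon> > 0" using \<epsilon>(1) by simp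
    ultimately show False using lt by linarith
  qed
  define N where "N = {v \<in> V - S. \<forall>u\<in>S. {v, u} \<in> edges G}"
  have finN: "finite N" and NV: "N \<subseteq> V - S" using V by (auto simp: N_def)
  have ct: "card S + 2 = t" "card S + 3 = t + 1" using cS k t by auto
  have cN: "card S + 2 \<le> card N"
  proof -
    have "P \<subseteq> N" using PI IV SI SP by (auto simp: N_def)
    then have "card P \<le> card N" by (rule card_mono[OF finN])
    then show ?thesis using v0(2) ct by (simp add: P_def S_def)
  qed
  let ?X = "\<Sum>v\<in>V - S. x v" and ?R = "V - S - N"
  \<comment> \<open>The reference structure puts all of \<open>V - S\<close> on the independent
    side. This raises every vertex of \<open>?R\<close> from a rate of at most
    \<open>e0 + ?K * \<epsilon>\<close> to \<open>?e\<close>.\<close>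
  have loss: "real k * edge_weight x E
      \<le> real k * edge_weight x (split_edges k S (V - S)) - real k * (?e - (e0 + ?K * \<epsilon>)) * (\<Sum>v\<in>?R. x v)"
    and sub: "{F \<in> E. F \<subseteq> S \<union> N} \<subseteq> split_edges k S N"
  proof -
    have minor': "\<not> clique_minor_in G V (card S + 2)" using minor ct by simp
    have xx: "0 \<le> x v \<and> x v \<le> 1" if "v \<in> V" for v using x(1) x1 that by simp
    note core = edge_weight_common_neighbours[OF V E cl loop minor' SV xx off less_imp_le[OF \<epsilon>(1)] e0,
      folded N_def, OF _ _ _ _ cN]
    show sub: "{F \<in> E. F \<subseteq> S \<union> N} \<subseteq> split_edges k S N" by (rule core(1))
    have "edge_weight x E \<le> edge_weight x {F \<in> E. F \<subseteq> S \<union> N} + (e0 + ?K * \<epsilon>) * (\<Sum>v\<in>?R. x v)"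
      using core(2) unfolding ct(2) unfolding cS by simp
    also have "edge_weight x {F \<in> E. F \<subseteq> S \<union> N} \<le> edge_weight x (split_edges k S N)"
    proof -
      have "0 \<le> x v" if "v \<in> S \<union> N" for v using that SV NV x(1) by blast
      then show ?thesis
        unfolding edge_weight_def using sub finS finN
        by (intro sum_mono2 prod_nonneg) (auto simp: split_edges_def nsets_def)
    qed
    also have "edge_weight x (split_edges k S N) = esym k x S + ?e * (\<Sum>v\<in>N. x v)"
      using finS finN NV k by (intro edge_weight_split_edges) auto
    finally have 1: "edge_weight x E \<le> esym k x S + ?e * (\<Sum>v\<in>N. x v) + (e0 + ?K * \<epsilon>) * (\<Sum>v\<in>?R. x v)"
      by simp
    have "?X = (\<Sum>v\<in>?R. x v) + (\<Sum>v\<in>N. x v)"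
      using V NV by (intro sum.subset_diff) auto
    then have "edge_weight x (split_edges k S (V - S)) = esym k x S + ?e * ((\<Sum>v\<in>?R. x v) + (\<Sum>v\<in>N. x v))"
      using finS V k by (subst edge_weight_split_edges) auto
    with 1 have "edge_weight x E \<le> edge_weight x (split_edges k S (V - S)) - (?e - (e0 + ?K * \<epsilon>)) * (\<Sum>v\<in>?R. x v)"
      by (simp add: algebra_simps)
    then have "real k * edge_weight x E \<le> real k * (edge_weight x (split_edges k S (V - S)) - (?e - (e0 + ?K * \<epsilon>)) * (\<Sum>v\<in>?R. x v))"
      by (rule mult_left_mono) simp
    then show "real k * edge_weight x E
      \<le> real k * edge_weight x (split_edges k S (V - S)) - real k * (?e - (e0 + ?K * \<epsilon>)) * (\<Sum>v\<in>?R. x v)"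
      by (simp only: mult.assoc right_diff_distrib[where b = "edge_weight x (split_edges k S (V - S))"])
  qed
  have cVS: "card (V - S) = n - (t - 2)" using cS cV finS SV by (simp add: card_Diff_subset)
  have neVS: "V - S \<noteq> {}" using cVS n by (metis card.empty zero_less_diff less_irrefl)
  have UV: "S \<union> (V - S) = V" using SV by blast
  have r': "real ((card S - 1) choose (k - 1)) < r" "B_equation k (card S) (card S + card (V - S)) r"
    using r n by (simp_all only: cS cVS le_add_diff_inverse less_imp_le)
  have kS: "k - 1 \<le> card S" using cS k t by simp
  have xV: "0 \<le> x v" if "v \<in> S \<union> (V - S)" for v using that x(1) UV by auto
  have upper: "real k * edge_weight x (split_edges k S (V - S)) \<le> r"
    using split_edges_weight_le(1)[where x = x, OF finS finite_Diff[OF V] Diff_disjoint k2 kS neVS xV r'] x(2) UV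
    by simp
  have upper': "real k * edge_weight x (split_edges k S (V - S)) < r" if "u \<in> V - S" "x u = 0" for u
    using split_edges_weight_le(2)[where x = x, OF finS finite_Diff[OF V] Diff_disjoint k2 kS neVS xV r' that S0] x(2) UV
    by simp
  have R0: "(\<Sum>v\<in>?R. x v) \<ge> 0" using x(1) by (intro sum_nonneg) auto
  have coef: "real k * (?e - (e0 + ?K * \<epsilon>)) > 0" using lt k0 by simp
  then have "real k * (?e - (e0 + ?K * \<epsilon>)) * (\<Sum>v\<in>?R. x v) \<ge> 0" using R0 by simp
  \<comment> \<open>The chain starts and ends at \<open>r\<close>, so the bound on the reference
    structure is attained and the loss term is zero.\<close>
  with loss upper le \<rho> have eqs: "real k * edge_weight x E = r"
    "real k * edge_weight x (split_edges k S (V - S)) = r"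
    "real k * (?e - (e0 + ?K * \<epsilon>)) * (\<Sum>v\<in>?R. x v) = 0"
    by linarith+
  \<comment> \<open>A zero entry would make the bound on the reference structure strict. Since the
    loss term vanishes with a positive coefficient, positive entries leave no room for
    \<open>?R\<close>.\<close>
  have pos_out: "x u > 0" if "u \<in> V - S" for u
    using upper'[OF that] eqs(2) x(1)[of u] that by fastforce
  have "?R = {}"
  proof (rule ccontr)
    assume "?R \<noteq> {}"
    then have "(\<Sum>v\<in>?R. x v) > 0" using V pos_out by (intro sum_pos) auto
    from mult_pos_pos[OF coef this] show False using eqs(3) by linarith
  qed
  then have NVS: "N = V - S" using NV by blast
  \<comment> \<open>Deleting a zero entry of \<open>S\<close> would not change \<open>?e\<close>,
    but proper subsets reach only \<open>e0\<close>.\<close>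
  have pos_in: "x u > 0" if "u \<in> S" for u
  proof (rule ccontr)
    assume "\<not> x u > 0"
    then have "x u = 0" using x(1)[of u] that SV by force
    then have "?e = esym (k - 1) x (S - {u})" using finS by (intro esym_zero_entry)
    moreover have "?K * \<epsilon> > 0" using \<epsilon>(1) by simp
    ultimately show False using e0[OF that] lt by linarith
  qed
  have posV: "x u > 0" if "u \<in> V" for u using pos_in pos_out that by blast
  have Esub: "E \<subseteq> split_edges k S (V - S)"
    using sub E unfolding NVS UV by (auto simp: nsets_def)
  have finE': "finite (split_edges k S (V - S))"
    using V SV finS by (simp add: split_edges_def)
  \<comment> \<open>With all entries positive, a missing edge would lower the weight
    strictly.\<close>
  have "E = split_edges k S (V - S)"
  proof (rule ccontr)
    assume "E \<noteq> split_edges k S (V - S)"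
    then have ne: "split_edges k S (V - S) - E \<noteq> {}" using Esub by blast
    have "0 < (\<Sum>F\<in>split_edges k S (V - S) - E. \<Prod>v\<in>F. x v)"
      using finE' ne posV UV by (intro sum_pos prod_pos) (auto simp: split_edges_def nsets_def)
    moreover have "edge_weight x (split_edges k S (V - S))
        = (\<Sum>F\<in>split_edges k S (V - S) - E. \<Prod>v\<in>F. x v) + edge_weight x E"
      unfolding edge_weight_def by (rule sum.subset_diff[OF Esub finE'])
    ultimately have "edge_weight x E < edge_weight x (split_edges k S (V - S))" by simp
    then have "real k * edge_weight x E < real k * edge_weight x (split_edges k S (V - S))" using k0 by simp
    then show False using eqs by simp
  qed
  then have "hypergraph_iso H (B_hypergraph k n t)"
    using finS V UV cS cVS by (intro hypergraph_iso_B_hypergraph[of S "V - S"]) (auto simp: V_def E_def)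
  then show ?thesis using eqs(1) \<rho> by simp
qed

text \<open>The threshold for \<open>n\<close> is uniform in \<open>H\<close>, as no constant
  depends on \<open>H\<close>. The implication from the lower bound covers both maximality and
  uniqueness.\<close>

lemma B_hypergraph_eventually_extremal:
  assumes k: "k \<ge> 3" and t: "t \<ge> k + 1"
  shows "\<forall>\<^sub>F n in sequentially.
    \<forall>H \<in> (minor_free_shadow_class k (complete_graph t) n :: 'a hypergraph set).
      spectral_radius k (B_hypergraph k n t) \<le> spectral_radius k H \<longrightarrow>
      spectral_radius k H = spectral_radius k (B_hypergraph k n t) \<and> hypergraph_iso H (B_hypergraph k n t)"
proof -
  define c where "c = B_constant k t"
  define \<gamma> where "\<gamma> = 1 - real (k - 2) / real (t - 3)"
  define K where "K = (2::real) ^ (2 ^ (t + 1) + 1 + (t - 2)) * real k"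
  define K' where "K' = (2::real) ^ 2 ^ (t + 1) * real k"
  have \<gamma>: "\<gamma> < 1" using k t by (simp add: \<gamma>_def)
  have c: "c > 0" using k t by (simp add: c_def B_constant_def zero_less_binomial_iff)
  have K: "K > 0" "K' > 0" using k by (simp_all add: K_def K'_def)
  \<comment> \<open>\<epsilon> comes from the gap, with a quarter in place of a half to make the
    required inequality strict; then \<delta>, \<tau> and \<open>M\<close> each from their
    predecessors. Only afterwards is \<open>n\<close> taken large.\<close>
  define \<epsilon> where "\<epsilon> = (1 - \<gamma>) / 4 * c / K"
  define \<delta> where "\<delta> = min (\<epsilon> ^ k) ((1 - \<gamma>) / 2)"
  define \<tau> where "\<tau> = min \<epsilon> (\<delta> / 4 * c / K')"
  define M where "M = nat \<lceil>1 / \<tau> ^ k\<rceil>"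
  have \<epsilon>: "0 < \<epsilon>" using \<gamma> c K by (simp add: \<epsilon>_def)
  have "K * \<epsilon> = (1 - \<gamma>) / 4 * c" using K by (simp add: \<epsilon>_def)
  also have "\<dots> < (1 - \<gamma>) / 2 * c" using \<gamma> c by simp
  finally have \<epsilon>K: "2 ^ (2 ^ (t + 1) + 1 + (t - 2)) * \<epsilon> * real k < (1 - \<gamma>) / 2 * c"
    by (simp only: K_def mult_ac)
  have \<delta>: "0 < \<delta>" "\<delta> \<le> \<epsilon> ^ k" "\<delta> \<le> (1 - \<gamma>) / 2"
    using \<epsilon> \<gamma> unfolding \<delta>_def by (simp, intro min.cobounded1, intro min.cobounded2)
  have \<tau>: "0 < \<tau>" "\<tau> \<le> \<epsilon>" using \<epsilon> \<delta> c K by (simp_all add: \<tau>_def)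
  have "\<tau> \<le> \<delta> / 4 * c / K'" by (simp add: \<tau>_def)
  then have "K' * \<tau> \<le> \<delta> / 4 * c" using K by (simp add: pos_le_divide_eq mult_ac)
  then have \<tau>K: "2 ^ 2 ^ (t + 1) * \<tau> * real k \<le> \<delta> / 4 * c" by (simp only: K'_def mult_ac)
  have M: "1 / \<tau> ^ k \<le> real M" unfolding M_def by (rule real_nat_ceiling_ge)
  define C where "C = real k * (2 ^ M + 2 ^ M * real t * 2 ^ M)"
  let ?Q = "\<lambda>n. real n powr ((real k - 1) / real k)"
  let ?\<rho> = "\<lambda>n. spectral_radius k (B_hypergraph k n t)"
  have "filterlim ?Q at_top sequentially"
    by (rule filterlim_compose[OF real_powr_at_top filterlim_real_sequentially]) (use k in simp)
  then have "\<forall>\<^sub>F n in sequentially. C / (\<delta> / 4 * c) < ?Q n"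
    by (rule filterlim_at_top_dense[THEN iffD1, rule_format])
  moreover have "\<forall>\<^sub>F n in sequentially. (1 - \<delta> / 4) * c < ?\<rho> n / ?Q n"
    using spectral_radius_B_hypergraph_asymp[of k t] k t \<delta> c
    by (intro order_tendstoD(1)[where y = c]) (auto simp: c_def)
  moreover have "\<forall>\<^sub>F n in sequentially. n > t - 2" by (rule eventually_gt_at_top)
  ultimately show ?thesis
  proof eventually_elim
    case (elim n)
    have Q: "?Q n > 0" using elim(3) by simp
    have 1: "C < \<delta> / 4 * c * ?Q n"
      using elim(1) \<delta> c by (simp add: pos_divide_less_eq mult.commute)
    have 2: "(1 - \<delta> / 4) * c * ?Q n < ?\<rho> n"
      using elim(2) Q by (simp add: pos_less_divide_eq)
    have "\<exists>!r. real ((t - 2 - 1) choose (k - 1)) < r \<and> B_equation k (t - 2) n r"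
      using k t elim(3) by (intro B_equation_unique_root) auto
    then obtain r where r: "real ((t - 2 - 1) choose (k - 1)) < r" "B_equation k (t - 2) n r" by blast
    have \<rho>: "?\<rho> n = r" using k t elim(3) r by (intro spectral_radius_B_hypergraph) auto
    show ?case
    proof (intro ballI impI)
      fix H :: "'a hypergraph"
      assume H: "H \<in> minor_free_shadow_class k (complete_graph t) n" and le: "?\<rho> n \<le> spectral_radius k H"
      show "spectral_radius k H = ?\<rho> n \<and> hypergraph_iso H (B_hypergraph k n t)"
        unfolding \<rho>
        using spectral_radius_ge_B_hypergraph_imp_iso[OF k t elim(3) H, folded c_def \<gamma>_def, OF \<delta> \<epsilon> \<epsilon>K \<tau> \<tau>K M 1[unfolded C_def]
          2[unfolded \<rho>] r le[unfolded \<rho>]] .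
    qed
  qed
qed

theorem theorem1p1:
  fixes k t a :: nat
  assumes "k \<ge> 3" and "t \<ge> k + 1" and "a = t - 2"
  shows "(\<forall>n\<ge>a + 1.
            B_hypergraph k n t \<in> minor_free_shadow_class k (complete_graph t) n
          \<and> spectral_radius k (B_hypergraph k n t) > real ((a - 1) choose (k - 1))
          \<and> B_equation k a n (spectral_radius k (B_hypergraph k n t))
          \<and> (\<forall>r. r > real ((a - 1) choose (k - 1)) \<and> B_equation k a n r
                \<longrightarrow> r = spectral_radius k (B_hypergraph k n t)))
       \<and> (\<exists>\<epsilon> :: nat \<Rightarrow> real. \<epsilon> \<longlonglongrightarrow> 0 \<and>
            (\<forall>n\<ge>a + 1. spectral_radius k (B_hypergraph k n t)
               = (B_constant k t + \<epsilon> n) * real n powr ((real k - 1) / real k)))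
       \<and> (t = k + 1 \<longrightarrow>
            (\<forall>n\<ge>a + 1. \<forall>r. B_equation k a n r \<longleftrightarrow> r ^ k = (real n - real k + 1) ^ (k - 1)))
       \<and> (\<forall>\<^sub>F n in sequentially.
            \<forall>H \<in> (minor_free_shadow_class k (complete_graph t) n :: 'a hypergraph set).
              spectral_radius k H \<le> spectral_radius k (B_hypergraph k n t)
            \<and> (spectral_radius k H = spectral_radius k (B_hypergraph k n t)
                 \<longrightarrow> hypergraph_iso H (B_hypergraph k n t)))"
proof (intro conjI)
  let ?\<rho> = "\<lambda>n. spectral_radius k (B_hypergraph k n t)"
  let ?Q = "\<lambda>n. real n powr ((real k - 1) / real k)"
  note k = assms(1) and t = assms(2) and a = assms(3)
  have root: "\<exists>!r. real ((a - 1) choose (k - 1)) < r \<and> B_equation k a n r" if "n \<ge> a + 1" for n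
    using that k t a by (intro B_equation_unique_root) auto
  have \<rho>: "?\<rho> n = r" if "n \<ge> a + 1" "real ((a - 1) choose (k - 1)) < r" "B_equation k a n r" for n r
    using that k t unfolding a by (intro spectral_radius_B_hypergraph) auto
  show "\<forall>n\<ge>a + 1.
            B_hypergraph k n t \<in> minor_free_shadow_class k (complete_graph t) n
          \<and> ?\<rho> n > real ((a - 1) choose (k - 1)) \<and> B_equation k a n (?\<rho> n)
          \<and> (\<forall>r. r > real ((a - 1) choose (k - 1)) \<and> B_equation k a n r \<longrightarrow> r = ?\<rho> n)"
  proof (intro allI impI)
    fix n assume n: "n \<ge> a + 1"
    obtain r where r: "real ((a - 1) choose (k - 1)) < r" "B_equation k a n r"
      using root[OF n] by blast
    have "B_hypergraph k n t \<in> minor_free_shadow_class k (complete_graph t) n"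
      using n k t a by (intro B_hypergraph_in_class) auto
    moreover have "s = r" if "real ((a - 1) choose (k - 1)) < s" "B_equation k a n s" for s
      using \<rho>[OF n that] \<rho>[OF n r] by simp
    ultimately show "B_hypergraph k n t \<in> minor_free_shadow_class k (complete_graph t) n
          \<and> ?\<rho> n > real ((a - 1) choose (k - 1)) \<and> B_equation k a n (?\<rho> n)
          \<and> (\<forall>r. r > real ((a - 1) choose (k - 1)) \<and> B_equation k a n r \<longrightarrow> r = ?\<rho> n)"
      unfolding \<rho>[OF n r] using r by blast
  qed
  show "\<exists>\<epsilon> :: nat \<Rightarrow> real. \<epsilon> \<longlonglongrightarrow> 0 \<and> (\<forall>n\<ge>a + 1. ?\<rho> n = (B_constant k t + \<epsilon> n) * ?Q n)"
  proof (intro exI conjI allI impI)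
    let ?\<epsilon> = "\<lambda>n. ?\<rho> n / ?Q n - B_constant k t"
    have "(\<lambda>n. ?\<rho> n / ?Q n) \<longlonglongrightarrow> B_constant k t"
      using k t by (intro spectral_radius_B_hypergraph_asymp) auto
    then show "?\<epsilon> \<longlonglongrightarrow> 0" by (simp only: LIM_zero)
    fix n assume "n \<ge> a + 1"
    then have "?Q n \<noteq> 0" by simp
    then show "?\<rho> n = (B_constant k t + ?\<epsilon> n) * ?Q n"
      by (simp only: add_diff_eq add_diff_cancel_left' times_divide_eq_left nonzero_mult_div_cancel_right not_False_eq_True)
  qed
  show "t = k + 1 \<longrightarrow>
      (\<forall>n\<ge>a + 1. \<forall>r. B_equation k a n r \<longleftrightarrow> r ^ k = (real n - real k + 1) ^ (k - 1))"
  proof (intro impI allI)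
    fix n :: nat and r :: real assume "t = k + 1" "n \<ge> a + 1"
    then have ak: "a = k - 1" using a by simp
    \<comment> \<open>With \<open>a = k - 1\<close> no edge fits inside the clique side, and each
      vertex of the independent side lies in exactly one edge.\<close>
    have b: "(a - 1) choose (k - 1) = 0" "(a - 1) choose (k - 2) = 1" "a choose (k - 1) = 1"
      using k by (simp_all add: ak diff_diff_eq numeral_2_eq_2)
    have d: "real n - real a = real n - real k + 1" using k by (simp add: ak of_nat_diff)
    have e: "r * r ^ (k - 1) = r ^ k" using k by (simp add: power_eq_if)
    show "B_equation k a n r \<longleftrightarrow> r ^ k = (real n - real k + 1) ^ (k - 1)"
      by (simp only: B_equation_def b d e of_nat_0 of_nat_1 diff_0_right power_one mult_1)
  qed
  show "\<forall>\<^sub>F n in sequentially.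
            \<forall>H \<in> (minor_free_shadow_class k (complete_graph t) n :: 'a hypergraph set).
              spectral_radius k H \<le> ?\<rho> n \<and> (spectral_radius k H = ?\<rho> n \<longrightarrow> hypergraph_iso H (B_hypergraph k n t))"
    using B_hypergraph_eventually_extremal[OF k t, where 'a = 'a]
  proof eventually_elim
    case (elim n)
    show ?case
    proof (intro ballI)
      fix H :: "'a hypergraph" assume "H \<in> minor_free_shadow_class k (complete_graph t) n"
      with elim have "?\<rho> n \<le> spectral_radius k H \<longrightarrow>
          spectral_radius k H = ?\<rho> n \<and> hypergraph_iso H (B_hypergraph k n t)" by blast
      then show "spectral_radius k H \<le> ?\<rho> n \<and> (spectral_radius k H = ?\<rho> n \<longrightarrow> hypergraph_iso H (B_hypergraph k n t))"
        using linear[of "?\<rho> n" "spectral_radius k H"] by auto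
    qed
  qed
qed

end
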